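(* Let $(M,\omega)$ be a compact connected symplectic manifold, let $\mathfrak b\subset C^\infty(M)$ be a finite-dimensional basic algebra of observables on $M$, and let $P(\mathfrak b)$ be the Poisson algebra of polynomials generated by $\mathfrak b$. There exists no nontrivial prequantization of $P(\mathfrak b)$ on a finite-dimensional Hilbert space. In particular, there exists no nontrivial quantization of $(P(\mathfrak b),\mathfrak b)$ on a finite-dimensional Hilbert space.
   Context: $C^\infty(M)$ denotes the real-valued smooth functions on $M$ with the Poisson bracket $\{\cdot,\cdot\}$ of $\omega$; $X_f$ is the Hamiltonian vector field of $f$; $\hbar>0$ is fixed. A basic algebra of observables is a Lie subalgebra $\mathfrak b\subset C^\infty(M)$ such that: (B1) $\mathfrak b$ is finitely generated as a Lie algebra; (B2) for every $f\in\mathfrak b$ the Hamiltonian vector field $X_f$ is complete; (B3) $\mathfrak b$ is transitive, i.e. $\{X_f(m)\mid f\in\mathfrak b\}$ spans $T_mM$ for every $m\in M$, and separating, i.e. for $m\neq m'$ in $M$ there is $f\in\mathfrak b$ with $f(m)\ne f(m')$; (B4) $\mathfrak b$ is minimal with these properties, i.e. no proper Lie subalgebra of $\mathfrak b$ satisfies (B1)-(B3). $P(\mathfrak b)\subset C^\infty(M)$ is the unital associative subalgebra generated by $\mathfrak b$ (all real polynomials in elements of $\mathfrak b$, including constants); it is a Poisson subalgebra. For a dense subspace $D$ of a separable complex Hilbert space $\mathcal H$, $\mathrm{Op}(D)$ is the linear space of symmetric operators on $D$ which preserve $D$. Let $\mathcal O\subset C^\infty(M)$ be a Lie subalgebra containing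 $1$. A prequantization of $\mathcal O$ is a linear map $\mathcal Q:\mathcal O\to \mathrm{Op}(D)$ such that for all $f,g\in\mathcal O$: (Q1) $\mathcal Q(\{f,g\})=\frac{i}{\hbar}[\mathcal Q(f),\mathcal Q(g)]$; (Q2) $\mathcal Q(1)=I$; (Q3) if $X_f$ is complete then $\mathcal Q(f)$ is essentially self-adjoint on $D$. It is nontrivial if $\ker\mathcal Q$ has codimension greater than $1$ in $\mathcal O$. If $\mathfrak b\subset\mathcal O$ is a basic algebra, a quantization of $(\mathcal O,\mathfrak b)$ is a prequantization $\mathcal Q$ of $\mathcal O$ such that: (Q4) $\mathcal Q(\mathfrak b)$ is irreducible, i.e. the only bounded self-adjoint operators on $\mathcal H$ that strongly commute (spectral resolutions commute) with the closures of all $\mathcal Q(f)$, $f\in\mathfrak b$, are multiples of $I$; (Q5) for some finite set $\{X_1,\dots,X_k\}$ generating the Lie algebra $\mathcal Q(\mathfrak b)$, there is a dense set of $\psi\in D$ such that for each $j$ the series $\sum_{m\ge0}\frac{\|X_j^m\psi\|}{m!}t^m$ converges for some $t>0$; (Q6) $\mathcal Q$ is injective on $\mathfrak b$. *)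

theory Defs
  imports "HOL-Analysis.Analysis" "HOL-Library.Function_Algebras"
begin

definition fscale :: "real \<Rightarrow> ('a \<Rightarrow> 'b::real_vector) \<Rightarrow> 'a \<Rightarrow> 'b" where
  "fscale r f = (\<lambda>x. r *\<^sub>R f x)"

global_interpretation fun_space: vector_space "fscale :: real \<Rightarrow> ('a \<Rightarrow> 'b::real_vector) \<Rightarrow> _"
  by unfold_locales (auto simp: fscale_def fun_eq_iff scaleR_add_right scaleR_add_left)

definition bracket_closed :: "('a \<Rightarrow> 'a \<Rightarrow> 'a) \<Rightarrow> 'a set \<Rightarrow> bool" where
  "bracket_closed br V \<longleftrightarrow> (\<forall>x\<in>V. \<forall>y\<in>V. br x y \<in> V)"

definition lie_hull ::
    "(('a \<Rightarrow> 'b::real_vector) \<Rightarrow> ('a \<Rightarrow> 'b) \<Rightarrow> ('a \<Rightarrow> 'b)) \<Rightarrow> ('a \<Rightarrow> 'b) set \<Rightarrow> ('a \<Rightarrow> 'b) set" where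
  "lie_hull br S = (\<lambda>V. fun_space.subspace V \<and> bracket_closed br V) hull S"

definition finite_dimensional :: "('a \<Rightarrow> 'b::real_vector) set \<Rightarrow> bool" where
  "finite_dimensional V \<longleftrightarrow> (\<exists>B. finite B \<and> B \<subseteq> V \<and> V \<subseteq> fun_space.span B)"

definition codim_le :: "nat \<Rightarrow> ('a \<Rightarrow> 'b::real_vector) set \<Rightarrow> ('a \<Rightarrow> 'b) set \<Rightarrow> bool" where
  "codim_le n K V \<longleftrightarrow>
     (\<exists>B. finite B \<and> card B \<le> n \<and> B \<subseteq> V \<and> V \<subseteq> fun_space.span (K \<union> B))"

definition poly_algebra :: "('a \<Rightarrow> real) set \<Rightarrow> ('a \<Rightarrow> real) set" where
  "poly_algebra b =
     (\<lambda>V. fun_space.subspace V \<and> 1 \<in> V \<and> (\<forall>f\<in>V. \<forall>g\<in>V. f * g \<in> V)) hull b"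

fun Ck_on :: "nat \<Rightarrow> 'e::real_normed_vector set \<Rightarrow> ('e \<Rightarrow> 'b::real_normed_vector) \<Rightarrow> bool" where
  "Ck_on 0 S f \<longleftrightarrow> continuous_on S f"
| "Ck_on (Suc k) S f \<longleftrightarrow>
     (\<forall>x\<in>S. f differentiable at x) \<and> (\<forall>v. Ck_on k S (\<lambda>x. frechet_derivative f (at x) v))"

definition smooth_on :: "'e::real_normed_vector set \<Rightarrow> ('e \<Rightarrow> 'b::real_normed_vector) \<Rightarrow> bool" where
  "smooth_on S f \<longleftrightarrow> (\<forall>k. Ck_on k S f)"

type_synonym ('m, 'e) chart = "'m set \<times> ('m \<Rightarrow> 'e)"

abbreviation chart_dom :: "('m, 'e) chart \<Rightarrow> 'm set" where
  "chart_dom c \<equiv> fst c"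

abbreviation chart_map :: "('m, 'e) chart \<Rightarrow> 'm \<Rightarrow> 'e" where
  "chart_map c \<equiv> snd c"

abbreviation chart_inv :: "('m, 'e) chart \<Rightarrow> 'e \<Rightarrow> 'm" where
  "chart_inv c \<equiv> inv_into (chart_dom c) (chart_map c)"

text \<open>
  The manifold is the whole type \<open>'m\<close>.  A Euclidean space type has positive dimension, so a
  zero-dimensional manifold, that is, a discrete space, cannot have charts in the sense below;
  it is represented by the empty atlas.  Conditions quantified over charts are then vacuous, as
  they should be when the tangent spaces are zero.
\<close>

locale smooth_manifold =
  fixes A :: "('m::{t2_space, second_countable_topology}, 'e::euclidean_space) chart set"
  assumes chart: "c \<in> A \<Longrightarrow> open (chart_dom c) \<and> open (chart_map c ` chart_dom c) \<and>
      homeomorphism (chart_dom c) (chart_map c ` chart_dom c) (chart_map c) (chart_inv c)"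
    and smooth_transition: "c \<in> A \<Longrightarrow> d \<in> A \<Longrightarrow>
      smooth_on (chart_map c ` (chart_dom c \<inter> chart_dom d)) (chart_map d \<circ> chart_inv c)"
    and cover: "(\<Union>c\<in>A. chart_dom c) = UNIV \<or> A = {} \<and> (\<forall>m::'m. open {m})"

definition smooth_functions ::
    "('m::topological_space, 'e::euclidean_space) chart set \<Rightarrow> ('m \<Rightarrow> real) set" where
  "smooth_functions A = {f. \<forall>c\<in>A. smooth_on (chart_map c ` chart_dom c) (f \<circ> chart_inv c)}"

definition differential :: "('m, 'e::euclidean_space) chart \<Rightarrow> ('m \<Rightarrow> real) \<Rightarrow> 'm \<Rightarrow> 'e \<Rightarrow> real" where
  "differential c f m = frechet_derivative (f \<circ> chart_inv c) (at (chart_map c m))"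

text \<open>
  A tangent vector at \<open>m\<close> is given by its coordinate vector in each chart around \<open>m\<close>.
  A 2-form is a family of local representatives: \<open>\<omega> c m u v\<close> is its value at \<open>m\<close> on the
  tangent vectors with coordinates \<open>u\<close>, \<open>v\<close> in the chart \<open>c\<close>, relevant only for
  \<open>m \<in> chart_dom c\<close>.  The last two assumptions are \<open>d\<omega> = 0\<close>, evaluated on constant coordinate
  fields, and the transformation law of the representatives under change of charts.
\<close>

type_synonym ('m, 'e) two_form = "('m, 'e) chart \<Rightarrow> 'm \<Rightarrow> 'e \<Rightarrow> 'e \<Rightarrow> real"

locale symplectic_manifold = smooth_manifold A
  for A :: "('m::{t2_space, second_countable_topology}, 'e::euclidean_space) chart set" +
  fixes \<omega> :: "('m, 'e) two_form"
  assumes bilinear: "c \<in> A \<Longrightarrow> m \<in> chart_dom c \<Longrightarrow> bilinear (\<omega> c m)"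
    and alternating: "c \<in> A \<Longrightarrow> m \<in> chart_dom c \<Longrightarrow> \<omega> c m u u = 0"
    and nondegenerate: "c \<in> A \<Longrightarrow> m \<in> chart_dom c \<Longrightarrow> (\<forall>v. \<omega> c m u v = 0) \<Longrightarrow> u = 0"
    and smooth_form: "c \<in> A \<Longrightarrow>
      smooth_on (chart_map c ` chart_dom c) (\<lambda>x. \<omega> c (chart_inv c x) u v)"
    and closed_form: "c \<in> A \<Longrightarrow> m \<in> chart_dom c \<Longrightarrow>
      differential c (\<lambda>p. \<omega> c p v w) m u
        + differential c (\<lambda>p. \<omega> c p w u) m v
        + differential c (\<lambda>p. \<omega> c p u v) m w = 0"
    and change_of_chart: "c \<in> A \<Longrightarrow> d \<in> A \<Longrightarrow> m \<in> chart_dom c \<Longrightarrow> m \<in> chart_dom d \<Longrightarrow>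
      \<omega> c m u v =
        \<omega> d m (frechet_derivative (chart_map d \<circ> chart_inv c) (at (chart_map c m)) u)
              (frechet_derivative (chart_map d \<circ> chart_inv c) (at (chart_map c m)) v)"

text \<open>
  \<open>ham_field \<omega> c f m\<close> is the coordinate vector of \<open>X\<^sub>f(m)\<close> in the chart \<open>c\<close>, with the sign
  convention \<open>\<omega>(X\<^sub>f, \<cdot>) = -df\<close>, for which \<open>{f, g} = \<omega>(X\<^sub>f, X\<^sub>g) = X\<^sub>f g\<close>.  Replacing \<open>\<omega>\<close> by \<open>-\<omega>\<close>
  passes to the opposite sign of the bracket.
\<close>

definition ham_field ::
    "('m, 'e::euclidean_space) two_form \<Rightarrow> ('m, 'e) chart \<Rightarrow> ('m \<Rightarrow> real) \<Rightarrow> 'm \<Rightarrow> 'e" where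
  "ham_field \<omega> c f m = (THE u. \<forall>v. \<omega> c m u v = - differential c f m v)"

text \<open>The value of the bracket does not depend on the chart; the second case occurs only in
  dimension zero.\<close>

definition poisson ::
    "('m, 'e::euclidean_space) chart set \<Rightarrow> ('m, 'e) two_form \<Rightarrow>
      ('m \<Rightarrow> real) \<Rightarrow> ('m \<Rightarrow> real) \<Rightarrow> 'm \<Rightarrow> real" where
  "poisson A \<omega> f g m =
     (if \<exists>c\<in>A. m \<in> chart_dom c
      then let c = (SOME c. c \<in> A \<and> m \<in> chart_dom c)
           in \<omega> c m (ham_field \<omega> c f m) (ham_field \<omega> c g m)
      else 0)"

definition complete_ham_field ::
    "('m::topological_space, 'e::euclidean_space) chart set \<Rightarrow> ('m, 'e) two_form \<Rightarrow>
      ('m \<Rightarrow> real) \<Rightarrow> bool" where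
  "complete_ham_field A \<omega> f \<longleftrightarrow>
     (\<forall>m. \<exists>\<gamma>::real \<Rightarrow> 'm. \<gamma> 0 = m \<and> continuous_on UNIV \<gamma> \<and>
        (\<forall>t. \<forall>c\<in>A. \<gamma> t \<in> chart_dom c \<longrightarrow>
           ((\<lambda>s. chart_map c (\<gamma> s)) has_vector_derivative ham_field \<omega> c f (\<gamma> t)) (at t)))"

definition lie_subalgebra ::
    "('m::topological_space, 'e::euclidean_space) chart set \<Rightarrow> ('m, 'e) two_form \<Rightarrow>
      ('m \<Rightarrow> real) set \<Rightarrow> bool" where
  "lie_subalgebra A \<omega> b \<longleftrightarrow>
     b \<subseteq> smooth_functions A \<and> fun_space.subspace b \<and> bracket_closed (poisson A \<omega>) b"

definition transitive_set ::
    "('m, 'e::euclidean_space) chart set \<Rightarrow> ('m, 'e) two_form \<Rightarrow> ('m \<Rightarrow> real) set \<Rightarrow> bool" where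
  "transitive_set A \<omega> b \<longleftrightarrow>
     (\<forall>c\<in>A. \<forall>m\<in>chart_dom c. span {ham_field \<omega> c f m | f. f \<in> b} = UNIV)"

definition separating :: "('m \<Rightarrow> real) set \<Rightarrow> bool" where
  "separating b \<longleftrightarrow> (\<forall>m m'. m \<noteq> m' \<longrightarrow> (\<exists>f\<in>b. f m \<noteq> f m'))"

definition finitely_generated ::
    "('m, 'e::euclidean_space) chart set \<Rightarrow> ('m, 'e) two_form \<Rightarrow> ('m \<Rightarrow> real) set \<Rightarrow> bool" where
  "finitely_generated A \<omega> b \<longleftrightarrow> (\<exists>S. finite S \<and> S \<subseteq> b \<and> lie_hull (poisson A \<omega>) S = b)"

definition pre_basic ::
    "('m::topological_space, 'e::euclidean_space) chart set \<Rightarrow> ('m, 'e) two_form \<Rightarrow>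
      ('m \<Rightarrow> real) set \<Rightarrow> bool" where
  "pre_basic A \<omega> b \<longleftrightarrow>
     lie_subalgebra A \<omega> b \<and>
     finitely_generated A \<omega> b \<and>
     (\<forall>f\<in>b. complete_ham_field A \<omega> f) \<and>
     transitive_set A \<omega> b \<and> separating b"

definition basic_algebra ::
    "('m::topological_space, 'e::euclidean_space) chart set \<Rightarrow> ('m, 'e) two_form \<Rightarrow>
      ('m \<Rightarrow> real) set \<Rightarrow> bool" where
  "basic_algebra A \<omega> b \<longleftrightarrow> pre_basic A \<omega> b \<and> (\<forall>b'. b' \<subset> b \<longrightarrow> \<not> pre_basic A \<omega> b')"

class complex_inner = real_inner +
  fixes scaleC :: "complex \<Rightarrow> 'a \<Rightarrow> 'a"  (infixr \<open>*\<^sub>C\<close> 75)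
    and cinner :: "'a \<Rightarrow> 'a \<Rightarrow> complex"
  assumes scaleC_add_right: "z *\<^sub>C (x + y) = z *\<^sub>C x + z *\<^sub>C y"
    and scaleC_add_left: "(z + w) *\<^sub>C x = z *\<^sub>C x + w *\<^sub>C x"
    and scaleC_scaleC: "z *\<^sub>C w *\<^sub>C x = (z * w) *\<^sub>C x"
    and scaleC_of_real: "of_real r *\<^sub>C x = r *\<^sub>R x"
    and cinner_commute: "cinner x y = cnj (cinner y x)"
    and cinner_add_right: "cinner x (y + y') = cinner x y + cinner x y'"
    and cinner_scaleC_right: "cinner x (z *\<^sub>C y) = z * cinner x y"
    and Re_cinner: "Re (cinner x y) = inner x y"

global_interpretation complex_space: vector_space "scaleC :: complex \<Rightarrow> 'a \<Rightarrow> 'a::complex_inner"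
proof unfold_locales
  show "1 *\<^sub>C x = x" for x :: 'a
    using scaleC_of_real[of 1 x] by simp
qed (simp_all add: scaleC_add_right scaleC_add_left scaleC_scaleC)

text \<open>\<^class>\<open>polish_space\<close> provides completeness and separability of the norm metric.\<close>

class separable_hilbert = complex_inner + polish_space

definition bounded_selfadjoint :: "('h::complex_inner \<Rightarrow> 'h) \<Rightarrow> bool" where
  "bounded_selfadjoint T \<longleftrightarrow>
     bounded_linear T \<and> (\<forall>z x. T (z *\<^sub>C x) = z *\<^sub>C T x) \<and>
     (\<forall>x y. cinner (T x) y = cinner x (T y))"

text \<open>Unbounded operators are represented by their graphs.\<close>

definition graph_of :: "'h set \<Rightarrow> ('h \<Rightarrow> 'h) \<Rightarrow> ('h \<times> 'h) set" where
  "graph_of D T = {(x, T x) | x. x \<in> D}"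

definition adjoint_graph :: "('h::complex_inner \<times> 'h) set \<Rightarrow> ('h \<times> 'h) set" where
  "adjoint_graph G = {(y, z). \<forall>(x, w)\<in>G. cinner y w = cinner z x}"

text \<open>For densely defined \<open>T\<close> the closure of a graph is single-valued as soon as it equals its
  adjoint.\<close>

definition ess_selfadjoint :: "'h::complex_inner set \<Rightarrow> ('h \<Rightarrow> 'h) \<Rightarrow> bool" where
  "ess_selfadjoint D T \<longleftrightarrow>
     closure D = UNIV \<and> adjoint_graph (closure (graph_of D T)) = closure (graph_of D T)"

definition projection_valued_measure :: "(real set \<Rightarrow> 'h::complex_inner \<Rightarrow> 'h) \<Rightarrow> bool" where
  "projection_valued_measure E \<longleftrightarrow>
     (\<forall>S\<in>sets borel. bounded_selfadjoint (E S)) \<and>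
     E UNIV = id \<and>
     (\<forall>S\<in>sets borel. \<forall>T\<in>sets borel. E (S \<inter> T) = E S \<circ> E T) \<and>
     (\<forall>S::nat \<Rightarrow> real set. range S \<subseteq> sets borel \<longrightarrow> disjoint_family S \<longrightarrow>
        (\<forall>x. (\<lambda>n. E (S n) x) sums E (\<Union>n. S n) x))"

text \<open>The measure \<open>S \<mapsto> \<langle>x, E(S)x\<rangle> = \<parallel>E(S)x\<parallel>\<^sup>2\<close>.\<close>

definition spectral_measure :: "(real set \<Rightarrow> 'h::complex_inner \<Rightarrow> 'h) \<Rightarrow> 'h \<Rightarrow> real measure" where
  "spectral_measure E x = measure_of UNIV (sets borel) (\<lambda>S. ennreal ((norm (E S x))\<^sup>2))"

text \<open>\<open>G = \<integral>\<lambda> dE(\<lambda>)\<close>: since \<open>G\<close> is linear, its diagonal matrix elements on its domain determine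
  it by polarization.\<close>

definition spectral_resolution ::
    "(real set \<Rightarrow> 'h::complex_inner \<Rightarrow> 'h) \<Rightarrow> ('h \<times> 'h) set \<Rightarrow> bool" where
  "spectral_resolution E G \<longleftrightarrow>
     projection_valued_measure E \<and>
     Domain G = {x. integrable (spectral_measure E x) (\<lambda>s. s\<^sup>2)} \<and>
     (\<forall>(x, y)\<in>G. cinner x y = of_real (\<integral>s. s \<partial>spectral_measure E x))"

definition strongly_commute :: "('h::complex_inner \<times> 'h) set \<Rightarrow> ('h \<times> 'h) set \<Rightarrow> bool" where
  "strongly_commute G H \<longleftrightarrow>
     (\<exists>E F. spectral_resolution E G \<and> spectral_resolution F H \<and>
        (\<forall>S\<in>sets borel. \<forall>T\<in>sets borel. E S \<circ> F T = F T \<circ> E S))"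

definition irreducible_family :: "'h::complex_inner set \<Rightarrow> ('h \<Rightarrow> 'h) set \<Rightarrow> bool" where
  "irreducible_family D F \<longleftrightarrow>
     (\<forall>B. bounded_selfadjoint B \<longrightarrow>
        (\<forall>T\<in>F. strongly_commute (graph_of UNIV B) (closure (graph_of D T))) \<longrightarrow>
        (\<exists>z. \<forall>x. B x = z *\<^sub>C x))"

text \<open>An operator on \<open>D\<close> is a total function that vanishes outside \<open>D\<close>, so that operators on \<open>D\<close>
  form a linear space under pointwise operations and are equal iff they agree on \<open>D\<close>.\<close>

definition Op :: "'h::complex_inner set \<Rightarrow> ('h \<Rightarrow> 'h) set" where
  "Op D = {T. (\<forall>x. x \<notin> D \<longrightarrow> T x = 0) \<and> T ` D \<subseteq> D \<and>
     (\<forall>x\<in>D. \<forall>y\<in>D. T (x + y) = T x + T y) \<and>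
     (\<forall>z. \<forall>x\<in>D. T (z *\<^sub>C x) = z *\<^sub>C T x) \<and>
     (\<forall>x\<in>D. \<forall>y\<in>D. cinner (T x) y = cinner x (T y))}"

definition id_op :: "'h::zero set \<Rightarrow> 'h \<Rightarrow> 'h" where
  "id_op D = (\<lambda>x. if x \<in> D then x else 0)"

definition op_bracket ::
    "real \<Rightarrow> ('h::complex_inner \<Rightarrow> 'h) \<Rightarrow> ('h \<Rightarrow> 'h) \<Rightarrow> 'h \<Rightarrow> 'h" where
  "op_bracket hbar S T = (\<lambda>x. (\<i> / of_real hbar) *\<^sub>C (S (T x) - T (S x)))"

definition prequantization ::
    "('m::topological_space, 'e::euclidean_space) chart set \<Rightarrow> ('m, 'e) two_form \<Rightarrow> real \<Rightarrow>
      'h::separable_hilbert set \<Rightarrow> ('m \<Rightarrow> real) set \<Rightarrow> (('m \<Rightarrow> real) \<Rightarrow> 'h \<Rightarrow> 'h) \<Rightarrow> bool" where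
  "prequantization A \<omega> hbar D \<O> Q \<longleftrightarrow>
     complex_space.subspace D \<and> closure D = UNIV \<and>
     Q ` \<O> \<subseteq> Op D \<and>
     (\<forall>f\<in>\<O>. \<forall>g\<in>\<O>. Q (f + g) = Q f + Q g) \<and>
     (\<forall>r. \<forall>f\<in>\<O>. Q (fscale r f) = fscale r (Q f)) \<and>
     (\<forall>f\<in>\<O>. \<forall>g\<in>\<O>. Q (poisson A \<omega> f g) = op_bracket hbar (Q f) (Q g)) \<and>
     Q 1 = id_op D \<and>
     (\<forall>f\<in>\<O>. complete_ham_field A \<omega> f \<longrightarrow> ess_selfadjoint D (Q f))"

definition nontrivial :: "('m \<Rightarrow> real) set \<Rightarrow> (('m \<Rightarrow> real) \<Rightarrow> 'h::complex_inner \<Rightarrow> 'h) \<Rightarrow> bool" where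
  "nontrivial \<O> Q \<longleftrightarrow> \<not> codim_le 1 {f \<in> \<O>. Q f = 0} \<O>"

text \<open>The Lie algebra of operators uses the bracket \<^const>\<open>op_bracket\<close>, under which symmetric
  operators are closed.\<close>

definition quantization ::
    "('m::topological_space, 'e::euclidean_space) chart set \<Rightarrow> ('m, 'e) two_form \<Rightarrow> real \<Rightarrow>
      'h::separable_hilbert set \<Rightarrow> ('m \<Rightarrow> real) set \<Rightarrow> ('m \<Rightarrow> real) set \<Rightarrow>
      (('m \<Rightarrow> real) \<Rightarrow> 'h \<Rightarrow> 'h) \<Rightarrow> bool" where
  "quantization A \<omega> hbar D \<O> b Q \<longleftrightarrow>
     prequantization A \<omega> hbar D \<O> Q \<and>
     irreducible_family D (Q ` b) \<and>
     (\<exists>X. finite X \<and> lie_hull (op_bracket hbar) X = Q ` b \<and>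
        (\<exists>W. W \<subseteq> D \<and> closure W = UNIV \<and>
           (\<forall>\<psi>\<in>W. \<forall>T\<in>X. \<exists>t>0. summable (\<lambda>k. norm ((T ^^ k) \<psi>) / fact k * t ^ k)))) \<and>
     inj_on Q b"

end

theory Submission
  imports Defs
begin

text \<open>
  Let \<open>P = P(b)\<close>.  The kernel \<open>K\<close> of a prequantization on a finite-dimensional space is a Lie ideal
  of finite codimension in \<open>P\<close>.  Then \<open>U = {f. {f, P} \<subseteq> K}\<close> is an associative subalgebra, because
  \<open>{fg, h} = {f, gh} + {g, fh}\<close>, and \<open>J = {f. f P \<subseteq> U}\<close> is a Poisson ideal of finite codimension.
  If \<open>P\<close> is not just \<open>\<real>\<close>, it is infinite-dimensional, whence \<open>J \<noteq> 0\<close>.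

  Every \<open>f \<in> P\<close> lies in a finite-dimensional subspace \<open>V\<close> that is stable under the brackets with
  \<open>b\<close>, hence under the Hamiltonian flows of \<open>b\<close>.  Among the functions in \<open>f + {b, V}\<close> with values in
  a fixed interval choose one with least maximum: it is constant, since by transitivity finitely
  many of its translates under flows average to a function with smaller maximum otherwise.  This
  replaces integration over \<open>M\<close> and gives \<open>P = \<real> + {b, P}\<close>.  Applied to \<open>- f\<^sup>2\<close> for some
  \<open>f \<noteq> 0\<close> in \<open>J\<close>, it gives a nonzero constant in \<open>J\<close>.  Therefore \<open>J = P\<close>, thus \<open>{P, P} \<subseteq> K\<close> and
  \<open>P = \<real> + K\<close>.
\<close>

section \<open>Finite-dimensional spaces of functions\<close>

lemma fscale_apply: "fscale r f x = r *\<^sub>R f x"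
  by (simp add: fscale_def)

lemma sum_fun_eval: "(\<Sum>i\<in>I. F i) x = (\<Sum>i\<in>I. F i x)"
  for F :: "'i \<Rightarrow> 'a \<Rightarrow> 'b::comm_monoid_add"
  by (induction I rule: infinite_finite_induct) auto

lemma finite_dimensional_subspace:
  assumes "finite_dimensional V" "W \<subseteq> V"
  shows "finite_dimensional W"
proof -
  obtain B where B: "finite B" "V \<subseteq> fun_space.span B"
    using assms(1) by (auto simp: finite_dimensional_def)
  obtain C where C: "C \<subseteq> W" "fun_space.independent C" "W \<subseteq> fun_space.span C"
    by (rule fun_space.maximal_independent_subset)
  have "finite C"
    using fun_space.independent_span_bound[OF B(1) C(2)] C(1) B(2) assms(2) by blast
  with C show ?thesis
    by (auto simp: finite_dimensional_def)
qed

lemma finite_dimensional_span: "finite B \<Longrightarrow> finite_dimensional (fun_space.span B)"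
  unfolding finite_dimensional_def using fun_space.span_superset by blast

text \<open>Evaluations at finitely many points separate a finite-dimensional function space; \<open>e\<close> is the
  basis dual to them.\<close>

lemma span_interpolation:
  fixes B :: "('a \<Rightarrow> real) set"
  assumes "finite B"
  shows "\<exists>X e. finite X \<and> e ` X \<subseteq> fun_space.span B \<and>
           (\<forall>x\<in>X. \<forall>y\<in>X. e x y = (if x = y then 1 else 0)) \<and>
           (\<forall>k\<in>fun_space.span B. k = (\<Sum>x\<in>X. fscale (k x) (e x)))"
  using assms
proof induction
  case empty
  show ?case
    by (rule exI[of _ "{}"]) simp
next
  case (insert f B)
  obtain X e where *: "finite X" "e ` X \<subseteq> fun_space.span B"
    "\<forall>x\<in>X. \<forall>y\<in>X. e x y = (if x = y then 1 else 0)"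
    "\<forall>k\<in>fun_space.span B. k = (\<Sum>x\<in>X. fscale (k x) (e x))"
    using insert.IH by (elim exE conjE)
  then have Xe: "finite X" "\<And>x. x \<in> X \<Longrightarrow> e x \<in> fun_space.span B"
    "\<And>x y. x \<in> X \<Longrightarrow> y \<in> X \<Longrightarrow> e x y = (if x = y then 1 else 0)"
    by blast+
  note rep = bspec[OF *(4)]
  have mono: "fun_space.span B \<subseteq> fun_space.span (insert f B)"
    by (rule fun_space.span_mono) auto
  \<comment> \<open>\<open>f'\<close> is \<open>f\<close> minus its interpolant and vanishes on
    \<open>X\<close>. If it is not zero, any point \<open>p\<close> with
    \<open>f' p \<noteq> 0\<close> can serve as the new node.\<close>
  define f' where "f' = f - (\<Sum>x\<in>X. fscale (f x) (e x))"
  have sumB: "(\<Sum>x\<in>X. fscale (c x) (e x)) \<in> fun_space.span B" for c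
    using Xe(2) by (intro fun_space.span_sum fun_space.span_scale)
  have f'_ins: "f' \<in> fun_space.span (insert f B)"
    unfolding f'_def using mono sumB
    by (intro fun_space.span_diff) (auto intro: fun_space.span_base)
  show ?case
  proof (cases "f' = 0")
    case True
    then have "f \<in> fun_space.span B"
      using sumB[of f] by (simp add: f'_def)
    then have "fun_space.span (insert f B) = fun_space.span B"
      by (rule fun_space.span_redundant)
    then show ?thesis
      using insert.IH by simp
  next
    case False
    then obtain p where p: "f' p \<noteq> 0"
      by (auto simp: fun_eq_iff)
    have f'X: "f' y = 0" if "y \<in> X" for y
    proof -
      have "(\<Sum>x\<in>X. f x * e x y) = (\<Sum>x\<in>X. if x = y then f x else 0)"
        using that by (intro sum.cong) (auto simp: Xe(3))
      then show ?thesis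
        using Xe(1) that by (simp add: f'_def sum_fun_eval fscale_apply)
    qed
    then have pX: "p \<notin> X"
      using p by auto
    define e0 where "e0 = fscale (1 / f' p) f'"
    \<comment> \<open>Lagrange update: subtracting a multiple of \<open>e0\<close> makes each old
      \<open>e x\<close> vanish at \<open>p\<close>, and its values on \<open>X\<close> are kept
      because \<open>e0\<close> vanishes there.\<close>
    define e' where "e' x = (if x = p then e0 else e x - fscale (e x p) e0)" for x
    have e0: "e0 \<in> fun_space.span (insert f B)" "e0 p = 1" "\<And>y. y \<in> X \<Longrightarrow> e0 y = 0"
      unfolding e0_def using f'_ins p f'X by (auto intro: fun_space.span_scale simp: fscale_apply)
    have "e' x \<in> fun_space.span (insert f B)" if "x \<in> insert p X" for x
      using that e0(1) Xe(2) mono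
      by (auto simp: e'_def intro!: fun_space.span_diff fun_space.span_scale)
    moreover have "e' x y = (if x = y then 1 else 0)" if "x \<in> insert p X" "y \<in> insert p X" for x y
      using that e0 Xe(3) pX by (auto simp: e'_def fscale_apply)
    moreover have "k = (\<Sum>x\<in>insert p X. fscale (k x) (e' x))"
      if "k \<in> fun_space.span (insert f B)" for k
    proof -
      obtain a where a: "k - fscale a f \<in> fun_space.span B"
        using \<open>k \<in> _\<close> by (auto simp: fun_space.span_insert)
      \<comment> \<open>Removing the \<open>f'\<close>-component from \<open>k\<close> leaves an
        element of \<open>fun_space.span B\<close> with the same values on \<open>X\<close>, so the
        induction hypothesis expands \<open>v\<close> with the coefficients
        \<open>k x\<close>.\<close>
      define v where "v = k - fscale (a * f' p) e0"
      have "fscale (a * f' p) e0 = fscale a f'"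
        using p by (simp add: e0_def)
      then have "v = (k - fscale a f) + fscale a (\<Sum>x\<in>X. fscale (f x) (e x))"
        by (simp add: v_def f'_def fun_space.scale_right_diff_distrib)
      then have v: "v \<in> fun_space.span B"
        using a sumB by (auto intro: fun_space.span_add fun_space.span_scale)
      have kX: "k x = v x" if "x \<in> X" for x
        using e0(3)[OF that] by (simp add: v_def fscale_apply)
      have v_eval: "v y = (\<Sum>x\<in>X. k x * e x y)" for y
        using fun_cong[OF rep[OF v], of y] kX by (simp add: sum_fun_eval fscale_apply)
      have "k y = (\<Sum>x\<in>insert p X. fscale (k x) (e' x)) y" for y
      proof -
        have "(\<Sum>x\<in>insert p X. fscale (k x) (e' x)) y
            = k p * e0 y + (\<Sum>x\<in>X. k x * (e x y - e x p * e0 y))"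
          using Xe(1) pX
          by (auto simp: sum_fun_eval e'_def fscale_apply intro!: sum.cong)
        also have "\<dots> = k p * e0 y + (\<Sum>x\<in>X. k x * e x y) - (\<Sum>x\<in>X. k x * e x p) * e0 y"
          by (simp add: algebra_simps sum_subtractf sum_distrib_left)
        also have "\<dots> = k p * e0 y + v y - v p * e0 y"
          by (simp only: v_eval)
        also have "\<dots> = k y"
          using e0(2) by (simp add: v_def fscale_apply algebra_simps)
        finally show ?thesis by simp
      qed
      then show ?thesis by blast
    qed
    ultimately show ?thesis
      using Xe(1) by (intro exI[of _ "insert p X"] exI[of _ e']) auto
  qed
qed

text \<open>Values at finitely many points serve as coordinates on \<open>V\<close>. They are
  continuous for pointwise convergence and take the place of a norm.\<close>

lemma finite_dimensional_interpolation:
  fixes V :: "('a \<Rightarrow> real) set"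
  assumes "fun_space.subspace V" "finite_dimensional V"
  obtains X e where "finite X" "\<And>x. x \<in> X \<Longrightarrow> e x \<in> V"
    "\<And>k. k \<in> V \<Longrightarrow> k = (\<Sum>x\<in>X. fscale (k x) (e x))"
proof -
  obtain B where B: "finite B" "B \<subseteq> V" "V \<subseteq> fun_space.span B"
    using assms(2) by (auto simp: finite_dimensional_def)
  then have V: "V = fun_space.span B"
    using assms(1) by (simp add: fun_space.span_minimal subset_antisym)
  show ?thesis
    using span_interpolation[OF B(1)] that unfolding V image_subset_iff by meson
qed

section \<open>Closedness and compactness for pointwise convergence\<close>

lemma continuous_on_eval: "continuous_on UNIV (\<lambda>k::'a \<Rightarrow> real. k x)"
  using continuous_on_product_coordinates[of x] by simp

text \<open>The interpolation formula turns membership in \<open>V\<close> into equations between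
  point evaluations, each a closed condition in the product topology.\<close>

lemma closed_finite_dimensional:
  fixes V :: "('a \<Rightarrow> real) set"
  assumes "fun_space.subspace V" "finite_dimensional V"
  shows "closed V"
proof -
  obtain X e where "finite X" and X: "\<And>x. x \<in> X \<Longrightarrow> e x \<in> V"
    and rep: "\<And>k. k \<in> V \<Longrightarrow> k = (\<Sum>x\<in>X. fscale (k x) (e x))"
    by (rule finite_dimensional_interpolation[OF assms]) (rule that)
  have "V = {k. \<forall>y. k y = (\<Sum>x\<in>X. k x * e x y)}"
  proof (intro equalityI subsetI)
    fix k assume k: "k \<in> V"
    have "k y = (\<Sum>x\<in>X. fscale (k x) (e x)) y" for y
      using fun_cong[OF rep[OF k], of y] .
    then show "k \<in> {k. \<forall>y. k y = (\<Sum>x\<in>X. k x * e x y)}"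
      unfolding sum_fun_eval fscale_apply real_scaleR_def mem_Collect_eq by blast
  next
    fix k assume k: "k \<in> {k. \<forall>y. k y = (\<Sum>x\<in>X. k x * e x y)}"
    define s where "s = (\<Sum>x\<in>X. fscale (k x) (e x))"
    have "k y = s y" for y
      using k unfolding s_def sum_fun_eval fscale_apply real_scaleR_def mem_Collect_eq by blast
    then have "k = s" by blast
    moreover have "s \<in> V"
      unfolding s_def using X
      by (intro fun_space.subspace_sum[OF assms(1)] fun_space.subspace_scale[OF assms(1)])
    ultimately show "k \<in> V" by simp
  qed
  moreover have "closed {k::'a \<Rightarrow> real. \<forall>y. k y = (\<Sum>x\<in>X. k x * e x y)}"
    by (intro closed_Collect_all closed_Collect_eq continuous_intros continuous_on_eval)
  ultimately show ?thesis by simp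
qed

text \<open>Tychonoff's theorem: the set is a product of closed intervals.\<close>

lemma compact_order_interval:
  "compact {k::'a \<Rightarrow> real. \<forall>x. lo \<le> k x \<and> k x \<le> hi}"
proof -
  have "compactin (product_topology (\<lambda>_::'a. euclideanreal) UNIV) (PiE UNIV (\<lambda>_. {lo..hi}))"
    by (subst compactin_PiE) auto
  then have "compact (PiE UNIV (\<lambda>_::'a. {lo..hi}))"
    by (simp add: euclidean_product_topology)
  moreover have "PiE UNIV (\<lambda>_::'a. {lo..hi}) = {k. \<forall>x. lo \<le> k x \<and> k x \<le> hi}"
    by (auto simp: PiE_def Pi_def)
  ultimately show ?thesis by simp
qed

section \<open>Averaging over Hamiltonian flows\<close>

text \<open>The interpolation formula expresses each value through finitely many others, so it
  survives a pointwise limit.\<close>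

lemma finite_dimensional_pointwise_limit:
  fixes W :: "('a \<Rightarrow> real) set"
  assumes "fun_space.subspace W" "finite_dimensional W"
    and "\<And>n. w n \<in> W" and "\<And>y. (\<lambda>n. w n y) \<longlonglongrightarrow> l y"
  shows "l \<in> W"
proof -
  obtain X e where "finite X" and X: "\<And>x. x \<in> X \<Longrightarrow> e x \<in> W"
    and rep: "\<And>k. k \<in> W \<Longrightarrow> k = (\<Sum>x\<in>X. fscale (k x) (e x))"
    by (rule finite_dimensional_interpolation[OF assms(1,2)]) (rule that)
  define s where "s = (\<Sum>x\<in>X. fscale (l x) (e x))"
  have "l y = s y" for y
  proof -
    have "(\<lambda>n. \<Sum>x\<in>X. w n x * e x y) \<longlonglongrightarrow> (\<Sum>x\<in>X. l x * e x y)"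
      by (intro tendsto_intros assms(4))
    moreover have "(\<Sum>x\<in>X. w n x * e x y) = w n y" for n
      using fun_cong[OF rep[OF assms(3)[of n]], of y]
      unfolding sum_fun_eval fscale_apply real_scaleR_def by (rule sym)
    ultimately have "(\<lambda>n. w n y) \<longlonglongrightarrow> (\<Sum>x\<in>X. l x * e x y)"
      by simp
    then have "l y = (\<Sum>x\<in>X. l x * e x y)"
      using assms(4) LIMSEQ_unique by blast
    then show ?thesis
      unfolding s_def sum_fun_eval fscale_apply real_scaleR_def .
  qed
  moreover have "s \<in> W"
    unfolding s_def using X
    by (intro fun_space.subspace_sum[OF assms(1)] fun_space.subspace_scale[OF assms(1)])
  ultimately show ?thesis
    by (metis ext)
qed

section \<open>Abstract Poisson algebras of functions and transitive flows\<close>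

locale poisson_function_algebra =
  fixes P :: "('m \<Rightarrow> real) set" and br :: "('m \<Rightarrow> real) \<Rightarrow> ('m \<Rightarrow> real) \<Rightarrow> 'm \<Rightarrow> real"
  assumes subspace: "fun_space.subspace P"
    and one: "1 \<in> P"
    and mult: "f \<in> P \<Longrightarrow> g \<in> P \<Longrightarrow> f * g \<in> P"
    and br_mem: "f \<in> P \<Longrightarrow> g \<in> P \<Longrightarrow> br f g \<in> P"
    and br_add: "f \<in> P \<Longrightarrow> g \<in> P \<Longrightarrow> h \<in> P \<Longrightarrow> br f (g + h) = br f g + br f h"
    and br_scale: "f \<in> P \<Longrightarrow> g \<in> P \<Longrightarrow> br f (fscale r g) = fscale r (br f g)"
    and skew: "f \<in> P \<Longrightarrow> g \<in> P \<Longrightarrow> br f g = - br g f"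
    and leibniz: "f \<in> P \<Longrightarrow> g \<in> P \<Longrightarrow> h \<in> P \<Longrightarrow> br f (g * h) = br f g * h + g * br f h"
begin

lemma add: "f \<in> P \<Longrightarrow> g \<in> P \<Longrightarrow> f + g \<in> P"
  and scale: "f \<in> P \<Longrightarrow> fscale r f \<in> P"
  and zero: "0 \<in> P"
  using subspace by (auto simp: fun_space.subspace_def)

lemma br_zero: "f \<in> P \<Longrightarrow> br f 0 = 0"
  using br_scale[of f 0 0] zero by simp

lemma br_sum:
  assumes "f \<in> P" "\<And>i. i \<in> I \<Longrightarrow> F i \<in> P"
  shows "br f (\<Sum>i\<in>I. F i) = (\<Sum>i\<in>I. br f (F i))"
  using assms(2)
proof (induction I rule: infinite_finite_induct)
  case (insert i I)
  then have "(\<Sum>i\<in>I. F i) \<in> P"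
    by (intro fun_space.subspace_sum[OF subspace]) auto
  then show ?case
    using insert br_add[OF assms(1), of "F i" "\<Sum>i\<in>I. F i"] by (simp add: plus_fun_def)
qed (simp_all add: br_zero assms(1))

end

text \<open>Collects what averaging uses of the manifold. \<open>\<phi> g\<close> is only a choice
  of an integral curve through each point. The condition \<open>transitive\<close> is the global
  form of infinitesimal transitivity on a connected manifold; \<open>locally_finite\<close> comes
  from the finite dimension of \<open>b\<close>.\<close>

locale transitive_poisson_algebra =
  poisson_function_algebra P br
  for P :: "('m::t2_space \<Rightarrow> real) set" and br +
  fixes b :: "('m \<Rightarrow> real) set" and \<phi> :: "('m \<Rightarrow> real) \<Rightarrow> real \<Rightarrow> 'm \<Rightarrow> 'm"
  assumes compact: "compact (UNIV :: 'm set)"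
    and generators: "b \<subseteq> P"
    and continuous: "f \<in> P \<Longrightarrow> continuous_on UNIV f"
    and flow_0: "g \<in> b \<Longrightarrow> \<phi> g 0 m = m"
    and flow_deriv: "g \<in> b \<Longrightarrow> h \<in> P \<Longrightarrow>
      ((\<lambda>t. h (\<phi> g t m)) has_real_derivative br g h (\<phi> g t m)) (at t)"
    and transitive: "closed Z \<Longrightarrow> Z \<noteq> {} \<Longrightarrow> (\<And>g t p. g \<in> b \<Longrightarrow> p \<in> Z \<Longrightarrow> \<phi> g t p \<in> Z) \<Longrightarrow> Z = UNIV"
    and locally_finite: "f \<in> P \<Longrightarrow> \<exists>V. fun_space.subspace V \<and> finite_dimensional V \<and> V \<subseteq> P \<and> f \<in> V \<and>
      (\<forall>g\<in>b. \<forall>h\<in>V. br g h \<in> V)"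
begin

lemma bounded_above:
  assumes "f \<in> P"
  obtains p where "\<And>m. f m \<le> f p"
  using continuous_attains_sup[OF compact _ continuous[OF assms]] that by auto

lemma bounded:
  assumes "f \<in> P"
  obtains M where "\<And>m. \<bar>f m\<bar> \<le> M"
proof -
  have "continuous_on UNIV (\<lambda>m. \<bar>f m\<bar>)"
    using continuous[OF assms] by (intro continuous_intros)
  then show ?thesis
    using continuous_attains_sup[OF compact, of "\<lambda>m. \<bar>f m\<bar>"] that by auto
qed

end

section \<open>Stable finite-dimensional subspaces and Taylor series along flows\<close>

locale invariant_subspace = transitive_poisson_algebra P br b \<phi>
  for P :: "('m::t2_space \<Rightarrow> real) set" and br b \<phi> +
  fixes V :: "('m \<Rightarrow> real) set"
  assumes V_subspace: "fun_space.subspace V" and V_finite: "finite_dimensional V"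
    and V_P: "V \<subseteq> P" and V_stable: "g \<in> b \<Longrightarrow> h \<in> V \<Longrightarrow> br g h \<in> V"
begin

text \<open>In the symplectic case these functions have integral zero for the Liouville measure, and
  the constant found by averaging is the mean value.\<close>

definition W :: "('m \<Rightarrow> real) set" where
  "W = fun_space.span {br g h | g h. g \<in> b \<and> h \<in> V}"

lemma W_subspace: "fun_space.subspace W"
  by (simp add: W_def)

lemma W_V: "W \<subseteq> V"
  unfolding W_def using V_stable by (intro fun_space.span_minimal V_subspace) auto

lemma W_finite: "finite_dimensional W"
  using V_finite W_V by (rule finite_dimensional_subspace)

lemma br_W: "g \<in> b \<Longrightarrow> h \<in> V \<Longrightarrow> br g h \<in> W"
  unfolding W_def by (rule fun_space.span_base) auto

text \<open>\<open>br g\<close> is a bounded operator on \<open>V\<close> for the sup norm: expand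
  \<open>k\<close> in the finite interpolation basis and use that each \<open>br g (e x)\<close> is
  bounded by compactness.\<close>

lemma br_bounded:
  assumes g: "g \<in> b"
  obtains C where "C \<ge> 0"
    "\<And>k M m. k \<in> V \<Longrightarrow> (\<And>m. \<bar>k m\<bar> \<le> M) \<Longrightarrow> \<bar>br g k m\<bar> \<le> C * M"
proof -
  obtain X e where X: "finite X" "\<And>x. x \<in> X \<Longrightarrow> e x \<in> V"
    and rep: "\<And>k. k \<in> V \<Longrightarrow> k = (\<Sum>x\<in>X. fscale (k x) (e x))"
    by (rule finite_dimensional_interpolation[OF V_subspace V_finite]) (rule that)
  have gP: "g \<in> P" using g generators by auto
  have eP: "e x \<in> P" if "x \<in> X" for x
    using X(2)[OF that] V_P by auto
  have "\<exists>M. \<forall>m. \<bar>br g (e x) m\<bar> \<le> M" if "x \<in> X" for x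
    using bounded[OF br_mem[OF gP eP[OF that]]] by metis
  then obtain N where N: "\<And>x m. x \<in> X \<Longrightarrow> \<bar>br g (e x) m\<bar> \<le> N x"
    by metis
  show thesis
  proof (rule that[of "\<Sum>x\<in>X. N x"])
    show "0 \<le> (\<Sum>x\<in>X. N x)"
      using N by (intro sum_nonneg) (meson abs_ge_zero order_trans)
    fix k M m assume k: "k \<in> V" "\<And>m. \<bar>k m\<bar> \<le> M"
    have "br g k m = br g (\<Sum>x\<in>X. fscale (k x) (e x)) m"
      by (rule arg_cong[where f = "\<lambda>f. br g f m"]) (rule rep[OF k(1)])
    also have "\<dots> = (\<Sum>x\<in>X. br g (fscale (k x) (e x))) m"
      using eP by (subst br_sum[OF gP]) (auto intro: scale)
    also have "\<dots> = (\<Sum>x\<in>X. k x * br g (e x) m)"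
      unfolding sum_fun_eval using eP gP by (intro sum.cong) (auto simp: br_scale fscale_apply)
    also have "\<bar>\<dots>\<bar> \<le> (\<Sum>x\<in>X. \<bar>k x * br g (e x) m\<bar>)"
      by (rule sum_abs)
    also have "\<dots> \<le> (\<Sum>x\<in>X. M * N x)"
      using k(2) N unfolding abs_mult
      by (intro sum_mono mult_mono) (auto intro: order_trans[OF abs_ge_zero])
    also have "\<dots> = (\<Sum>x\<in>X. N x) * M"
      by (simp add: sum_distrib_left mult.commute)
    finally show "\<bar>br g k m\<bar> \<le> (\<Sum>x\<in>X. N x) * M" .
  qed
qed

text \<open>The Taylor series of \<open>h\<close> along the flow converges pointwise, and all its terms of positive
  order lie in the closed subspace \<open>W\<close>.\<close>

lemma flow_W:
  assumes g: "g \<in> b" and h: "h \<in> V"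
  shows "(\<lambda>m. h (\<phi> g t m)) - h \<in> W"
proof -
  define a where "a n = (br g ^^ n) h" for n
  have a0: "a 0 = h" and aSuc: "a (Suc n) = br g (a n)" for n
    by (simp_all add: a_def)
  have aV: "a n \<in> V" for n
    by (induction n) (simp_all add: a0 aSuc h V_stable[OF g])
  have aW: "a (Suc n) \<in> W" for n
    unfolding aSuc using g aV by (rule br_W)
  obtain C where C: "C \<ge> 0"
    "\<And>k M m. k \<in> V \<Longrightarrow> (\<And>m. \<bar>k m\<bar> \<le> M) \<Longrightarrow> \<bar>br g k m\<bar> \<le> C * M"
    using br_bounded[OF g] by blast
  obtain M where M: "\<And>m. \<bar>h m\<bar> \<le> M"
    using bounded h V_P by blast
  \<comment> \<open>Iterated brackets are the derivatives along the flow; their geometric growth is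
    beaten by the factorials in the Taylor remainder.\<close>
  have bound: "\<bar>a n m\<bar> \<le> C ^ n * M" for n m
  proof (induction n arbitrary: m)
    case (Suc n)
    then show ?case
      unfolding aSuc using C(2)[OF aV, of n "C ^ n * M" m] by (simp add: mult.assoc)
  qed (simp add: a0 M)
  \<comment> \<open>The Taylor polynomial of degree \<open>n\<close> without its order-zero term
    \<open>h\<close>; each remaining term is a multiple of a bracket and hence lies in
    \<open>W\<close>.\<close>
  define w where "w n = (\<Sum>j<n. fscale (t ^ Suc j / fact (Suc j)) (a (Suc j)))" for n
  have w: "w n \<in> W" for n
    unfolding w_def using aW
    by (intro fun_space.subspace_sum[OF W_subspace] fun_space.subspace_scale[OF W_subspace])
  have lim: "(\<lambda>n. w n m) \<longlonglongrightarrow> ((\<lambda>m. h (\<phi> g t m)) - h) m" for m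
  proof -
    have est: "\<bar>((\<lambda>m. h (\<phi> g t m)) - h) m - w n m\<bar> \<le> M * ((C * \<bar>t\<bar>) ^ Suc n / fact (Suc n))" for n
    proof -
      \<comment> \<open>\<open>d n\<close> is the \<open>n\<close>-th derivative of
        \<open>s \<mapsto> h (\<phi> g s m)\<close>, so Maclaurin's formula applies with a remainder
        of order \<open>Suc n\<close>.\<close>
      define d where "d n s = a n (\<phi> g s m)" for n s
      have "\<forall>n s. (d n has_real_derivative d (Suc n) s) (at s)"
        unfolding d_def aSuc using flow_deriv[OF g] aV V_P by blast
      then obtain s where s: "h (\<phi> g t m) =
          (\<Sum>j<Suc n. d j 0 / fact j * t ^ j) + d (Suc n) s / fact (Suc n) * t ^ Suc n"
        using Maclaurin_all_le[of d "\<lambda>s. h (\<phi> g s m)" t "Suc n"]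
        by (auto simp: d_def a0 fun_eq_iff)
      have "(\<Sum>j<Suc n. d j 0 / fact j * t ^ j) = h m + w n m"
        unfolding sum.lessThan_Suc_shift
        by (simp add: d_def flow_0[OF g] a0 w_def sum_fun_eval fscale_apply mult.commute
            del: fact_Suc power_Suc)
      then have "((\<lambda>m. h (\<phi> g t m)) - h) m - w n m = d (Suc n) s / fact (Suc n) * t ^ Suc n"
        using s by simp
      also have "\<bar>\<dots>\<bar> = \<bar>d (Suc n) s\<bar> * (\<bar>t\<bar> ^ Suc n / fact (Suc n))"
        by (simp add: abs_mult power_abs del: fact_Suc)
      also have "\<dots> \<le> (C ^ Suc n * M) * (\<bar>t\<bar> ^ Suc n / fact (Suc n))"
        unfolding d_def by (intro mult_right_mono bound) (simp del: fact_Suc)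
      also have "\<dots> = M * ((C * \<bar>t\<bar>) ^ Suc n / fact (Suc n))"
        by (simp add: power_mult_distrib del: fact_Suc)
      finally show ?thesis .
    qed
    have "(\<lambda>n. inverse (fact n) * (C * \<bar>t\<bar>) ^ n) \<longlonglongrightarrow> 0"
      by (rule summable_LIMSEQ_zero[OF summable_exp])
    then have "(\<lambda>n. (C * \<bar>t\<bar>) ^ n / fact n) \<longlonglongrightarrow> 0"
      by (simp add: divide_inverse mult.commute)
    then have "(\<lambda>n. M * ((C * \<bar>t\<bar>) ^ Suc n / fact (Suc n))) \<longlonglongrightarrow> M * 0"
      by (intro tendsto_intros) (rule LIMSEQ_Suc)
    then have "(\<lambda>n. M * ((C * \<bar>t\<bar>) ^ Suc n / fact (Suc n))) \<longlonglongrightarrow> 0"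
      by simp
    then have "(\<lambda>n. ((\<lambda>m. h (\<phi> g t m)) - h) m - w n m) \<longlonglongrightarrow> 0"
      by (rule Lim_null_comparison[rotated]) (intro always_eventually allI, unfold real_norm_def, rule est)
    from tendsto_diff[OF tendsto_const this, of "((\<lambda>m. h (\<phi> g t m)) - h) m"]
    show ?thesis by simp
  qed
  show ?thesis
    by (rule finite_dimensional_pointwise_limit[OF W_subspace W_finite w lim])
qed

section \<open>Minimising the maximum over a compact family\<close>

definition comparison :: "('m \<Rightarrow> real) \<Rightarrow> real \<Rightarrow> real \<Rightarrow> ('m \<Rightarrow> real) set" where
  "comparison h lo hi = {k. k - h \<in> W} \<inter> {k. \<forall>m. lo \<le> k m \<and> k m \<le> hi}"

text \<open>A closed affine subspace meets a compact order interval; the bounds \<open>lo\<close>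
  and \<open>hi\<close> supply the compactness.\<close>

lemma compact_comparison: "compact (comparison h lo hi)"
proof -
  have "closed W"
    by (rule closed_finite_dimensional[OF W_subspace W_finite])
  moreover have "continuous_on UNIV (\<lambda>k. k - h)"
    unfolding fun_diff_def
    by (intro continuous_on_coordinatewise_then_product continuous_intros continuous_on_eval)
  ultimately have "closed ((\<lambda>k. k - h) -` W)"
    by (rule closed_vimage)
  then show ?thesis
    unfolding comparison_def vimage_def
    by (rule closed_Int_compact[OF _ compact_order_interval])
qed

lemma comparison_V:
  assumes "h \<in> V" "k \<in> comparison h lo hi"
  shows "k \<in> V"
  using fun_space.subspace_add[OF V_subspace assms(1), of "k - h"] W_V assms(2)
  by (auto simp: comparison_def)

text \<open>Composition with the flow changes \<open>k\<close> by an element of \<open>W\<close> and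
  takes values only from the range of \<open>k\<close>, so both constraints persist.\<close>

lemma comparison_flow:
  assumes "h \<in> V" "k \<in> comparison h lo hi" "g \<in> b"
  shows "(\<lambda>m. k (\<phi> g t m)) \<in> comparison h lo hi"
proof -
  have "(\<lambda>m. k (\<phi> g t m)) - h = ((\<lambda>m. k (\<phi> g t m)) - k) + (k - h)"
    by simp
  also have "\<dots> \<in> W"
    using flow_W[OF assms(3) comparison_V[OF assms(1,2)]] assms(2)
    by (intro fun_space.subspace_add[OF W_subspace]) (auto simp: comparison_def)
  finally show ?thesis
    using assms(2) by (simp add: comparison_def)
qed

text \<open>By transitivity every point can be moved to one where \<open>k < M\<close>; averaging \<open>k\<close> over finitely
  many of these motions pushes the maximum below \<open>M\<close>.\<close>

lemma comparison_improve:
  assumes h: "h \<in> V" and k: "k \<in> comparison h lo hi" and M: "\<And>m. k m \<le> M" and m0: "k m0 < M"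
  shows "\<exists>k'\<in>comparison h lo hi. \<exists>M'<M. \<forall>m. k' m \<le> M'"
proof -
  define S where "S = {k \<in> comparison h lo hi. \<forall>m. k m \<le> M}"
  have cont: "continuous_on UNIV k'" if "k' \<in> S" for k'
  proof -
    have "k' \<in> comparison h lo hi"
      using that by (simp add: S_def)
    then show ?thesis
      using comparison_V[OF h] V_P continuous by blast
  qed
  have "\<exists>k'\<in>S. k' p < M" for p
  proof (rule ccontr)
    assume p: "\<not> (\<exists>k'\<in>S. k' p < M)"
    \<comment> \<open>\<open>Z\<close> is where every competitor equals \<open>M\<close>. It is
      closed, and it is invariant since \<open>S\<close> is stable under composition with the flows;
      a single point in it would therefore force \<open>k m0 = M\<close>.\<close>
    define Z where "Z = (\<Inter>k'\<in>S. {q. k' q = M})"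
    have "closed Z"
      unfolding Z_def using cont by (intro closed_INT ballI closed_Collect_eq continuous_intros)
    moreover have "Z \<noteq> {}"
    proof -
      have "k' p = M" if "k' \<in> S" for k'
        using p that by (intro order.antisym) (auto simp: S_def not_less)
      then show ?thesis
        by (auto simp: Z_def)
    qed
    moreover have "\<phi> g t q \<in> Z" if "g \<in> b" "q \<in> Z" for g t q
    proof -
      have "(\<lambda>m. k' (\<phi> g t m)) \<in> S" if "k' \<in> S" for k'
        using comparison_flow[OF h _ \<open>g \<in> b\<close>] that by (simp add: S_def)
      moreover have "\<forall>k'\<in>S. k' q = M"
        using \<open>q \<in> Z\<close> by (simp add: Z_def)
      ultimately have "k' (\<phi> g t q) = M" if "k' \<in> S" for k'
        using that by fast
      then show ?thesis
        by (simp add: Z_def)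
    qed
    ultimately have "Z = UNIV"
      by (rule transitive)
    then have "m0 \<in> Z" by simp
    moreover have "k \<in> S"
      using k M by (simp add: S_def)
    ultimately show False
      using m0 by (auto simp: Z_def)
  qed
  then have cover: "UNIV \<subseteq> (\<Union>k'\<in>S. {q. k' q < M})"
    by blast
  have "open {q. k' q < M}" if "k' \<in> S" for k'
    using cont[OF that] by (intro open_Collect_less continuous_on_const)
  then obtain I where I: "I \<subseteq> S" "finite I" "UNIV \<subseteq> (\<Union>k'\<in>I. {q. k' q < M})"
    by (rule compactE_image[OF compact _ cover])
  then have I0: "I \<noteq> {}" by auto
  have cI: "card I > 0" using I(2) I0 by (simp add: card_gt_0_iff)
  \<comment> \<open>At each point some member of \<open>I\<close> is strictly below \<open>M\<close>
    and none exceeds it, so the mean is below \<open>M\<close> everywhere, and uniformly so because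
    it attains its maximum.\<close>
  define k' where "k' = fscale (1 / card I) (\<Sum>i\<in>I. i)"
  have k'_eval: "k' m = (\<Sum>i\<in>I. i m) / card I" for m
    by (simp add: k'_def fscale_apply sum_fun_eval)
  have "(\<Sum>i\<in>I. i) - fscale (real (card I)) h = (\<Sum>i\<in>I. i - h)"
    by (simp add: fun_eq_iff sum_fun_eval sum_subtractf fscale_apply)
  moreover have "k' - h = fscale (1 / card I) ((\<Sum>i\<in>I. i) - fscale (real (card I)) h)"
    using cI by (simp add: k'_def fun_space.scale_right_diff_distrib)
  moreover have "(\<Sum>i\<in>I. i - h) \<in> W"
    using I(1) by (intro fun_space.subspace_sum[OF W_subspace]) (auto simp: S_def comparison_def)
  ultimately have "k' - h \<in> W"
    by (simp add: fun_space.subspace_scale[OF W_subspace])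
  moreover have "lo \<le> k' m \<and> k' m \<le> hi" for m
  proof -
    have "card I * lo \<le> (\<Sum>i\<in>I. i m)" "(\<Sum>i\<in>I. i m) \<le> card I * hi"
      using I(1) sum_bounded_below[of I lo "\<lambda>i. i m"] sum_bounded_above[of I "\<lambda>i. i m" hi]
      by (auto simp: S_def comparison_def)
    then show ?thesis
      using cI by (simp add: k'_eval field_simps)
  qed
  ultimately have k': "k' \<in> comparison h lo hi"
    by (simp add: comparison_def)
  have less: "k' m < M" for m
  proof -
    have "(\<Sum>i\<in>I. i m) < (\<Sum>i\<in>I. M)"
      using I by (intro sum_strict_mono_ex1) (auto simp: S_def)
    then show ?thesis
      using cI by (simp add: k'_eval field_simps)
  qed
  obtain p where "\<And>m. k' m \<le> k' p"
    using bounded_above comparison_V[OF h k'] V_P by blast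
  then show ?thesis
    using k' less by blast
qed

text \<open>The least maximum is attained by compactness, and a minimiser that is not constant could
  be improved. The strict inequality later shows that a constant is nonzero.\<close>

lemma average:
  assumes h: "h \<in> V"
  obtains c where "(\<lambda>_. c) - h \<in> W"
    "\<And>M m0. (\<And>m. h m \<le> M) \<Longrightarrow> h m0 < M \<Longrightarrow> c < M"
proof -
  obtain B where B: "\<And>m. \<bar>h m\<bar> \<le> B"
    using bounded h V_P by blast
  let ?C = "comparison h (- B) B"
  have hC: "h \<in> ?C"
    using B fun_space.subspace_0[OF W_subspace] by (auto simp: comparison_def abs_le_iff minus_le_iff)
  \<comment> \<open>\<open>R\<close> consists of the upper bounds that competitors can achieve. The
    sets \<open>{k. \<forall>m. k m \<le> M}\<close> are nested, so a finite intersection is decided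
    by the least \<open>M\<close> involved.\<close>
  define R where "R = {M. \<exists>k\<in>?C. \<forall>m. k m \<le> M}"
  have "?C \<inter> (\<Inter>M\<in>R. {k. \<forall>m. k m \<le> M}) \<noteq> {}"
  proof (rule compact_imp_fip_image[OF compact_comparison])
    show "closed {k :: 'm \<Rightarrow> real. \<forall>m. k m \<le> M}" for M
      by (intro closed_Collect_all closed_Collect_le continuous_intros continuous_on_eval)
    fix I assume I: "finite I" "I \<subseteq> R"
    show "?C \<inter> (\<Inter>M\<in>I. {k. \<forall>m. k m \<le> M}) \<noteq> {}"
    proof (cases "I = {}")
      case False
      then have "Min I \<in> R" using I Min_in by blast
      then obtain k where k: "k \<in> ?C" "\<And>m. k m \<le> Min I"
        by (auto simp: R_def)
      have "k m \<le> M" if "M \<in> I" for M m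
        using k(2)[of m] Min_le[OF I(1) that] by linarith
      then show ?thesis
        using k(1) by blast
    qed (use hC in auto)
  qed
  then obtain k where k: "k \<in> ?C" "\<And>M m. M \<in> R \<Longrightarrow> k m \<le> M"
    by auto
  obtain p where p: "\<And>m. k m \<le> k p"
    using bounded_above comparison_V[OF h k(1)] V_P by blast
  have "k m = k p" for m
  proof (rule ccontr)
    assume "k m \<noteq> k p"
    then have "k m < k p"
      using p[of m] by simp
    then obtain k' M' where "k' \<in> ?C" "M' < k p" "\<forall>m. k' m \<le> M'"
      using comparison_improve[OF h k(1) p] by blast
    moreover from this have "M' \<in> R"
      by (auto simp: R_def)
    ultimately show False
      using k(2)[of M' p] by simp
  qed
  then have kc: "k = (\<lambda>_. k p)" by blast
  show thesis
  proof (rule that[of "k p"])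
    show "(\<lambda>_. k p) - h \<in> W"
      using k(1) kc by (simp add: comparison_def)
    fix M m0 assume "\<And>m. h m \<le> M" "h m0 < M"
    then obtain k' M' where "k' \<in> ?C" "M' < M" "\<forall>m. k' m \<le> M'"
      using comparison_improve[OF h hC] by blast
    moreover from this have "M' \<in> R"
      by (auto simp: R_def)
    ultimately show "k p < M"
      using k(2)[of M' p] by simp
  qed
qed

end

section \<open>Lie ideals of finite codimension\<close>

text \<open>Linearity is confined to \<open>P\<close> because a prequantization is linear only on
  its domain.\<close>

definition functional_on :: "('a \<Rightarrow> real) set \<Rightarrow> (('a \<Rightarrow> real) \<Rightarrow> real) \<Rightarrow> bool" where
  "functional_on P l \<longleftrightarrow>
     (\<forall>f\<in>P. \<forall>g\<in>P. l (f + g) = l f + l g) \<and> (\<forall>r. \<forall>f\<in>P. l (fscale r f) = r * l f)"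

text \<open>Imposing one more linear equation enlarges the finite complement by at most one
  vector.\<close>

lemma joint_kernel_cofinite:
  assumes P: "fun_space.subspace P" and "finite L" "\<And>l. l \<in> L \<Longrightarrow> functional_on P l"
  shows "\<exists>B. finite B \<and> B \<subseteq> P \<and> P \<subseteq> fun_space.span ({f \<in> P. \<forall>l\<in>L. l f = 0} \<union> B)"
  using assms(2,3)
proof (induction L)
  case empty
  show ?case
    by (rule exI[of _ "{}"]) (simp add: fun_space.span_superset)
next
  case (insert l L)
  define N where "N = {f \<in> P. \<forall>\<mu>\<in>L. \<mu> f = 0}"
  define N' where "N' = {f \<in> N. l f = 0}"
  have N': "{f \<in> P. \<forall>\<mu>\<in>insert l L. \<mu> f = 0} = N'"
    by (auto simp: N_def N'_def)
  obtain B where B: "finite B" "B \<subseteq> P" "P \<subseteq> fun_space.span (N \<union> B)"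
    using insert by (auto simp: N_def)
  show ?case
  proof (cases "\<forall>f\<in>N. l f = 0")
    case True
    then have "N' = N" by (auto simp: N'_def)
    then show ?thesis
      unfolding N' using B by auto
  next
    case False
    then obtain v where v: "v \<in> N" "l v \<noteq> 0" by auto
    have vP: "v \<in> P" using v by (simp add: N_def)
    have "f \<in> fun_space.span (N' \<union> insert v B)" if f: "f \<in> N" for f
    proof -
      \<comment> \<open>The multiple of \<open>v\<close> to subtract so that \<open>l\<close>
        vanishes; the functionals in \<open>L\<close> already vanish on \<open>f\<close> and
        \<open>v\<close>.\<close>
      define a where "a = l f / l v"
      have fP: "f \<in> P" using f by (simp add: N_def)
      have svP: "fscale (- a) v \<in> P"
        using P vP by (rule fun_space.subspace_scale)
      define g where "g = f + fscale (- a) v"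
      have lin: "\<mu> g = \<mu> f - a * \<mu> v" if "\<mu> \<in> insert l L" for \<mu>
        using insert.prems[OF that] fP vP svP
        by (simp add: g_def functional_on_def del: fun_space.scale_minus_left)
      have "g \<in> P"
        unfolding g_def using P fP svP by (rule fun_space.subspace_add)
      moreover have "\<mu> g = 0" if "\<mu> \<in> L" for \<mu>
        using lin[of \<mu>] that f v(1) by (auto simp: N_def)
      moreover have "l g = 0"
        using lin[of l] v(2) by (simp add: a_def)
      ultimately have "g \<in> N'"
        by (simp add: N'_def N_def)
      then have "g + fscale a v \<in> fun_space.span (N' \<union> insert v B)"
        by (intro fun_space.span_add fun_space.span_scale) (auto intro: fun_space.span_base)
      then show ?thesis by (simp add: g_def)
    qed
    then have "fun_space.span (N \<union> B) \<subseteq> fun_space.span (N' \<union> insert v B)"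
      by (intro fun_space.span_minimal) (auto intro: fun_space.span_base)
    then show ?thesis
      unfolding N' using B vP by (intro exI[of _ "insert v B"]) auto
  qed
qed

context transitive_poisson_algebra
begin

text \<open>A nonconstant continuous function on a connected space has infinitely many values. In
  finite dimension a polynomial in \<open>f\<close> vanishing at all interpolation points would be
  zero, yet it is nonzero where \<open>f\<close> takes another value.\<close>

lemma infinite_dimensional:
  assumes "connected (UNIV :: 'm set)" "f \<in> P" "f m0 \<noteq> f m1"
  shows "\<not> finite_dimensional P"
proof
  assume "finite_dimensional P"
  then obtain X e where X: "finite X"
    and rep: "\<And>k. k \<in> P \<Longrightarrow> k = (\<Sum>x\<in>X. fscale (k x) (e x))"
    using finite_dimensional_interpolation[OF subspace] by (metis (no_types))
  define k where "k = (\<Prod>x\<in>X. f - fscale (f x) 1)"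
  have k_eval: "k m = (\<Prod>x\<in>X. f m - f x)" for m
    unfolding k_def using X by (induction X rule: finite_induct) (auto simp: fscale_apply)
  have "k \<in> P"
    unfolding k_def using X
  proof (induction X rule: finite_induct)
    case (insert x X)
    show ?case
      unfolding prod.insert[OF insert.hyps]
      by (intro mult fun_space.subspace_diff[OF subspace] assms(2) scale one insert.IH)
  next
    case empty
    show ?case
      unfolding prod.empty by (rule one)
  qed
  moreover have "k x = 0" if "x \<in> X" for x
    using X that by (auto simp: k_eval intro!: prod_zero)
  ultimately have k0: "k m = 0" for m
    using fun_cong[OF rep, of k m] by (simp add: sum_fun_eval fscale_apply)
  have "connected (range f)"
    using assms(1) continuous[OF assms(2)] by (rule connected_continuous_image[rotated])
  then have "infinite (range f)"
    using assms(3) connected_finite_iff_sing[of "range f"] by (metis empty_iff rangeI singletonD)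
  then obtain m where "f m \<notin> f ` X"
    using X by (meson finite_imageI finite_subset image_subset_iff subsetI rangeE)
  then show False
    using k0[of m] X by (auto simp: k_eval)
qed

text \<open>The finite codimension of \<open>K\<close> is given through functionals, since composing
  them with multiplications produces the finitely many equations that put a function into the
  associative ideal \<open>J\<close>.\<close>

lemma cofinite_lie_ideal:
  assumes conn: "connected (UNIV :: 'm set)"
    and L: "finite L" "\<And>l. l \<in> L \<Longrightarrow> functional_on P l"
    and K: "fun_space.subspace K" "K \<subseteq> P" "{f \<in> P. \<forall>l\<in>L. l f = 0} \<subseteq> K"
    and ideal: "\<And>f g. f \<in> K \<Longrightarrow> g \<in> P \<Longrightarrow> br f g \<in> K"
  shows "P \<subseteq> fun_space.span (K \<union> {1})"
proof (cases "\<forall>f\<in>P. \<forall>m m'. f m = f m'")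
  case True
  have "f \<in> fun_space.span (K \<union> {1})" if "f \<in> P" for f
  proof -
    have "f = fscale (f undefined) 1"
      using True that by (auto simp: fun_eq_iff fscale_apply)
    moreover have "fscale (f undefined) 1 \<in> fun_space.span (K \<union> {1})"
      by (intro fun_space.span_scale fun_space.span_base) simp
    ultimately show ?thesis by simp
  qed
  then show ?thesis by blast
next
  case False
  then have infinite_dim: "\<not> finite_dimensional P"
    using infinite_dimensional[OF conn] by blast
  define U where "U = {f \<in> P. \<forall>h\<in>P. br f h \<in> K}"
  define J where "J = {f \<in> P. \<forall>h\<in>P. f * h \<in> U}"
  note K_add = fun_space.subspace_add[OF K(1)]
  have br_left_add: "br (f + g) h = br f h + br g h" if "f \<in> P" "g \<in> P" "h \<in> P" for f g h
    using that by (simp add: skew[of _ h] br_add add)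
  have br_left_scale: "br (fscale r f) h = fscale r (br f h)" if "f \<in> P" "h \<in> P" for r f h
    using that by (simp add: skew[of _ h] br_scale scale)
  have br_left_zero: "br 0 h = 0" if "h \<in> P" for h
    using that by (simp add: skew[of 0 h] br_zero zero)
  have U: "fun_space.subspace U"
    unfolding U_def using K(1)
    by (auto simp: fun_space.subspace_def br_left_add br_left_scale br_left_zero zero add scale)
  have KU: "K \<subseteq> U"
    using K(2) ideal by (auto simp: U_def)
  have U_mult: "f * g \<in> U" if "f \<in> U" "g \<in> U" for f g
  proof -
    have fg: "f \<in> P" "g \<in> P" using that by (auto simp: U_def)
    \<comment> \<open>The terms \<open>br f g * h\<close> and \<open>br g f * h\<close> on the right
      cancel by skew symmetry; both summands lie in \<open>K\<close> as \<open>f\<close> and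
      \<open>g\<close> are in \<open>U\<close>.\<close>
    have "br (f * g) h = br f (g * h) + br g (f * h)" if h: "h \<in> P" for h
    proof -
      have "br (f * g) h = br f h * g + f * br g h"
        using fg h by (simp add: skew[of _ h] leibniz mult)
      also have "\<dots> = br f (g * h) + br g (f * h)"
        using fg h by (simp add: leibniz skew[of g f] algebra_simps)
      finally show ?thesis .
    qed
    then show ?thesis
      using that fg K_add by (auto simp: U_def mult)
  qed
  have J_mult: "f * h \<in> J" if "f \<in> J" "h \<in> P" for f h
    using that by (auto simp: J_def mult mult.assoc)
  have JU: "f \<in> U" if "f \<in> J" for f
    using that one by (auto simp: J_def)
  have J: "fun_space.subspace J"
  proof -
    have "fscale r f * h = fscale r (f * h)" for r and f h :: "'m \<Rightarrow> real"
      by (simp add: fun_eq_iff fscale_apply)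
    then show ?thesis
      using U by (auto simp: J_def fun_space.subspace_def zero add scale algebra_simps)
  qed
  have J_br: "br g f \<in> J" if "f \<in> J" "g \<in> P" for f g
  proof -
    have f: "f \<in> P" using that by (simp add: J_def)
    \<comment> \<open>The Leibniz rule writes \<open>br g f * p\<close> through
      \<open>br (f * g) p\<close>, \<open>f * br p g\<close> and \<open>br f (g * p)\<close>. The
      first and last lie in \<open>K\<close> as \<open>f * g\<close> and \<open>f\<close> are in
      \<open>U\<close>, the middle one in \<open>U\<close> as \<open>f\<close> is in
      \<open>J\<close>.\<close>
    have "br g f * p \<in> U" if p: "p \<in> P" for p
    proof -
      have 1: "br f (g * p) \<in> U"
        using JU[OF \<open>f \<in> J\<close>] p \<open>g \<in> P\<close> by (intro KU[THEN subsetD]) (simp add: U_def mult)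
      have 2: "br (f * g) p \<in> U"
        using JU[OF J_mult[OF \<open>f \<in> J\<close> \<open>g \<in> P\<close>]] p by (intro KU[THEN subsetD]) (simp add: U_def)
      have 3: "f * br p g \<in> U"
        using \<open>f \<in> J\<close> p \<open>g \<in> P\<close> by (auto simp: J_def br_mem)
      have "br f (g * p) = br f g * p + g * br f p"
        using f p \<open>g \<in> P\<close> by (simp add: leibniz)
      moreover have "br (f * g) p = br f p * g + f * br g p"
        using f p \<open>g \<in> P\<close> by (simp add: skew[of _ p] leibniz mult)
      ultimately have "br g f * p = (br (f * g) p + f * br p g) - br f (g * p)"
        using f p \<open>g \<in> P\<close> by (simp add: skew[of g f] skew[of g p] algebra_simps)
      then show ?thesis
        using fun_space.subspace_diff[OF U fun_space.subspace_add[OF U 2 3] 1] by simp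
    qed
    then show ?thesis
      using f \<open>g \<in> P\<close> by (simp add: J_def br_mem)
  qed
  obtain f where f: "f \<in> J" "f \<noteq> 0"
  proof (rule ccontr)
    assume "\<not> thesis"
    then have J0: "J \<subseteq> {0}" using that by auto
    obtain B where B: "finite B" "B \<subseteq> P" "P \<subseteq> fun_space.span ({f \<in> P. \<forall>l\<in>L. l f = 0} \<union> B)"
      using joint_kernel_cofinite[OF subspace L] by blast
    \<comment> \<open>If all of \<open>L'\<close> vanishes on \<open>f\<close>, then
      \<open>f\<close> and all \<open>f * p\<close> with \<open>p \<in> B\<close> lie in
      \<open>K\<close>. Since \<open>U\<close> contains \<open>K\<close> and is multiplicative,
      products with all of \<open>P\<close> land in \<open>U\<close>, so \<open>J\<close> has finite
      codimension.\<close>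
    define L' where "L' = L \<union> (\<lambda>(l, p) f. l (f * p)) ` (L \<times> B)"
    have "functional_on P (\<lambda>f. l (f * p))" if "l \<in> L" "p \<in> B" for l p
    proof -
      have "fscale r f * p = fscale r (f * p)" for r f
        by (simp add: fun_eq_iff fscale_apply)
      then show ?thesis
        using L(2)[OF that(1)] that(2) B(2) by (auto simp: functional_on_def mult distrib_right)
    qed
    then have "finite L'" "\<And>l. l \<in> L' \<Longrightarrow> functional_on P l"
      using L B(1) by (auto simp: L'_def)
    from joint_kernel_cofinite[OF subspace this]
    obtain B' where B': "finite B'" "B' \<subseteq> P" "P \<subseteq> fun_space.span ({f \<in> P. \<forall>l\<in>L'. l f = 0} \<union> B')"
      by blast
    have "f \<in> J" if f: "f \<in> P" "\<forall>l\<in>L'. l f = 0" for f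
    proof -
      have fU: "f \<in> U"
        using f K(3) KU by (auto simp: L'_def)
      have fB: "f * p \<in> U" if "p \<in> B" for p
        using that f B(2) K(3) KU by (force simp: L'_def mult)
      have subspace_p: "fun_space.subspace {p. f * p \<in> U}"
      proof -
        have "f * fscale r p = fscale r (f * p)" for r p
          by (simp add: fun_eq_iff fscale_apply)
        then show ?thesis
          using U by (auto simp: fun_space.subspace_def distrib_left)
      qed
      have "{f \<in> P. \<forall>l\<in>L. l f = 0} \<union> B \<subseteq> {p. f * p \<in> U}"
        using K(3) KU U_mult[OF fU] fB by auto
      from B(3) fun_space.span_minimal[OF this subspace_p] have "P \<subseteq> {p. f * p \<in> U}"
        by (rule subset_trans)
      then show ?thesis
        using f(1) by (auto simp: J_def)
    qed
    then have "{f \<in> P. \<forall>l\<in>L'. l f = 0} \<union> B' \<subseteq> insert 0 B'"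
      using J0 by auto
    then have "P \<subseteq> fun_space.span (insert 0 B')"
      using B'(3) fun_space.span_mono by blast
    then show False
      using infinite_dim finite_dimensional_subspace[OF finite_dimensional_span] B'(1) by blast
  qed
  have "1 \<in> J"
  proof -
    define h where "h = - (f * f)"
    have hJ: "h \<in> J"
      using f(1) J_mult[OF f(1)] fun_space.subspace_neg[OF J] by (auto simp: h_def J_def)
    then obtain V where V: "fun_space.subspace V" "finite_dimensional V" "V \<subseteq> P" "h \<in> V"
      "\<And>g h. g \<in> b \<Longrightarrow> h \<in> V \<Longrightarrow> br g h \<in> V"
      using locally_finite[of h] by (auto simp: J_def)
    \<comment> \<open>Cutting \<open>V\<close> down to the Poisson ideal \<open>J\<close> keeps it
      stable and places \<open>W\<close> in \<open>J\<close>, so the constant produced from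
      \<open>h\<close> also lies in \<open>J\<close>.\<close>
    interpret invariant_subspace P br b \<phi> "V \<inter> J"
      using V J J_br generators
      by unfold_locales (auto intro: finite_dimensional_subspace fun_space.subspace_inter)
    obtain c where c: "(\<lambda>_. c) - h \<in> W"
      "\<And>M m0. (\<And>m. h m \<le> M) \<Longrightarrow> h m0 < M \<Longrightarrow> c < M"
      using average[of h] V(4) hJ by blast
    obtain m0 where "f m0 \<noteq> 0"
      using f(2) by (auto simp: fun_eq_iff)
    then have "c < 0"
      by (intro c(2)[of 0 m0]) (auto simp: h_def zero_less_mult_iff linorder_neq_iff)
    have "(\<lambda>_. c) \<in> J"
      using fun_space.subspace_add[OF J _ hJ, of "(\<lambda>_. c) - h"] c(1) W_V by auto
    moreover have "1 = fscale (1 / c) (\<lambda>_::'m. c)"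
      using \<open>c < 0\<close> by (auto simp: fun_eq_iff fscale_apply)
    ultimately show ?thesis
      using fun_space.subspace_scale[OF J] by metis
  qed
  then have PU: "f \<in> U" if "f \<in> P" for f
    using that by (auto simp: J_def)
  have "f \<in> fun_space.span (K \<union> {1})" if f: "f \<in> P" for f
  proof -
    obtain V where V: "fun_space.subspace V" "finite_dimensional V" "V \<subseteq> P" "f \<in> V"
      "\<And>g h. g \<in> b \<Longrightarrow> h \<in> V \<Longrightarrow> br g h \<in> V"
      using locally_finite[OF f] by auto
    interpret invariant_subspace P br b \<phi> V
      using V by unfold_locales auto
    obtain c where c: "(\<lambda>_. c) - f \<in> W"
      using average[OF V(4)] by blast
    \<comment> \<open>With \<open>1 \<in> J\<close> all of \<open>P\<close> equals \<open>U\<close>,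
      so every bracket lies in \<open>K\<close> and averaging expresses \<open>f\<close> as a
      constant modulo \<open>K\<close>.\<close>
    have "W \<subseteq> K"
      unfolding W_def using PU V(3) generators
      by (intro fun_space.span_minimal[OF _ K(1)]) (auto simp: U_def)
    then have "(\<lambda>_. c) - f \<in> fun_space.span (K \<union> {1})"
      using c by (intro fun_space.span_base) auto
    moreover have "fscale c 1 \<in> fun_space.span (K \<union> {1})"
      by (intro fun_space.span_scale fun_space.span_base) simp
    ultimately have "fscale c 1 - ((\<lambda>_. c) - f) \<in> fun_space.span (K \<union> {1})"
      by (rule fun_space.span_diff[rotated])
    moreover have "fscale c 1 - ((\<lambda>_. c) - f) = f"
      by (auto simp: fun_eq_iff fscale_apply)
    ultimately show ?thesis by simp
  qed
  then show ?thesis by blast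
qed

end

section \<open>Hamiltonian flows\<close>

text \<open>A first-order class on which the bracket rules are proved: the product rule gives
  closure under products, so it contains all polynomials in smooth functions.\<close>

definition differentiable_functions ::
    "('m::topological_space, 'e::euclidean_space) chart set \<Rightarrow> ('m \<Rightarrow> real) set" where
  "differentiable_functions A =
     {f. \<forall>c\<in>A. \<forall>m\<in>chart_dom c. (f \<circ> chart_inv c) differentiable (at (chart_map c m))}"

lemma smooth_functions_differentiable: "smooth_functions A \<subseteq> differentiable_functions A"
proof
  fix f assume f: "f \<in> smooth_functions A"
  show "f \<in> differentiable_functions A"
    unfolding differentiable_functions_def
  proof (intro CollectI ballI)
    fix c m assume c: "c \<in> A" "m \<in> chart_dom c"
    then have "Ck_on (Suc 0) (chart_map c ` chart_dom c) (f \<circ> chart_inv c)"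
      using f by (simp add: smooth_functions_def smooth_on_def del: Ck_on.simps)
    then show "(f \<circ> chart_inv c) differentiable (at (chart_map c m))"
      using c by simp
  qed
qed

text \<open>Separates off dimension zero, where the atlas is empty; here every point has a
  chart.\<close>

locale symplectic_atlas = symplectic_manifold A \<omega>
  for A :: "('m::{t2_space, second_countable_topology}, 'e::euclidean_space) chart set" and \<omega> +
  assumes nonempty: "A \<noteq> {}"
begin

lemma chart_inv_map [simp]:
  assumes "c \<in> A" "m \<in> chart_dom c"
  shows "chart_inv c (chart_map c m) = m"
  using chart[OF assms(1)] assms(2) by (auto simp: homeomorphism_def)

definition chart_at :: "'m \<Rightarrow> ('m, 'e) chart" where
  "chart_at m = (SOME c. c \<in> A \<and> m \<in> chart_dom c)"

lemma ex_chart: "\<exists>c\<in>A. m \<in> chart_dom c"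
  using cover nonempty by auto

lemma chart_at: "chart_at m \<in> A" "m \<in> chart_dom (chart_at m)"
proof -
  have "\<exists>c. c \<in> A \<and> m \<in> chart_dom c"
    using ex_chart by blast
  then have "chart_at m \<in> A \<and> m \<in> chart_dom (chart_at m)"
    unfolding chart_at_def by (rule someI_ex)
  then show "chart_at m \<in> A" "m \<in> chart_dom (chart_at m)" by auto
qed

section \<open>Differentials, Hamiltonian fields and the bracket in charts\<close>

lemma differential:
  assumes "f \<in> differentiable_functions A" "c \<in> A" "m \<in> chart_dom c"
  shows "((f \<circ> chart_inv c) has_derivative differential c f m) (at (chart_map c m))"
  using assms unfolding differential_def differentiable_functions_def
  by (simp add: frechet_derivative_works)

lemma differential_eqI:
  assumes "((f \<circ> chart_inv c) has_derivative f') (at (chart_map c m))"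
  shows "differential c f m = f'"
  unfolding differential_def by (rule frechet_derivative_at[OF assms, symmetric])

lemma continuous_differentiable_function:
  assumes "f \<in> differentiable_functions A"
  shows "continuous_on UNIV f"
  unfolding continuous_on_eq_continuous_at[OF open_UNIV]
proof
  fix m
  let ?c = "chart_at m"
  have c: "open (chart_dom ?c)" "continuous_on (chart_dom ?c) (chart_map ?c)"
    using chart[OF chart_at(1)] by (auto simp: homeomorphism_def)
  have "continuous_on (chart_map ?c ` chart_dom ?c) (f \<circ> chart_inv ?c)"
    using has_derivative_continuous[OF differential[OF assms chart_at(1)]]
    by (intro continuous_at_imp_continuous_on) blast
  with c(2) have "continuous_on (chart_dom ?c) ((f \<circ> chart_inv ?c) \<circ> chart_map ?c)"
    by (rule continuous_on_compose)
  then have "continuous_on (chart_dom ?c) f"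
    by (rule continuous_on_eq) (simp add: chart_at)
  then show "isCont f m"
    using c(1) chart_at(2) by (simp add: continuous_on_eq_continuous_at)
qed

text \<open>Nondegeneracy makes \<open>u \<mapsto> \<omega> c m u\<close> injective, hence onto the
  dual space in finite dimension; the definite description in \<open>ham_field\<close> is therefore
  meaningful.\<close>

lemma ham_field:
  assumes "f \<in> differentiable_functions A" "c \<in> A" "m \<in> chart_dom c"
  shows "\<omega> c m (ham_field \<omega> c f m) v = - differential c f m v"
proof -
  have bil: "bilinear (\<omega> c m)"
    using assms(2,3) by (rule bilinear)
  interpret D: bounded_linear "differential c f m"
    using differential[OF assms] by (rule has_derivative_bounded_linear)
  have lin: "linear (\<omega> c m u)" "linear (\<lambda>u. \<omega> c m u v)" for u v
    using bil by (auto simp: bilinear_def)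
  have ext: "\<alpha> = \<beta>" if "linear \<alpha>" "linear \<beta>" "\<And>i. i \<in> Basis \<Longrightarrow> \<alpha> i = \<beta> i"
    for \<alpha> \<beta> :: "'e \<Rightarrow> real"
    using that linear_eq_stdbasis by blast
  \<comment> \<open>The inner product identifies functionals with vectors and turns the form into an
    endomorphism of \<open>'e\<close>, for which injectivity implies surjectivity.\<close>
  define L where "L u = (\<Sum>i\<in>Basis. \<omega> c m u i *\<^sub>R i)" for u
  have L_inner: "L u \<bullet> i = \<omega> c m u i" if "i \<in> Basis" for u i
    using that by (simp add: L_def)
  have L: "linear L"
    unfolding L_def
    by (rule linearI)
      (simp_all add: linear_add[OF lin(2)] linear_scale[OF lin(2)] scaleR_add_left sum.distrib
        scaleR_sum_right)
  have "inj L"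
  proof (subst linear_injective_0[OF L], intro allI impI)
    fix u assume "L u = 0"
    then have "\<omega> c m u = (\<lambda>_. 0)"
      using L_inner by (intro ext lin linear_zero) (metis inner_zero_left)
    then show "u = 0"
      using nondegenerate[OF assms(2,3)] by simp
  qed
  then have "surj L"
    by (rule linear_inj_imp_surj[OF L])
  then obtain u where u: "L u = (\<Sum>i\<in>Basis. (- differential c f m i) *\<^sub>R i)"
    by (metis surj_def)
  have "\<omega> c m u i = - differential c f m i" if "i \<in> Basis" for i
    using arg_cong[OF u, of "\<lambda>x. x \<bullet> i"] that by (simp add: L_inner del: scaleR_minus_left)
  then have u': "\<omega> c m u = (\<lambda>v. - differential c f m v)"
    by (intro ext lin linear_compose_neg D.linear)
  have "ham_field \<omega> c f m = u"
    unfolding ham_field_def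
  proof (rule the_equality)
    fix w assume w: "\<forall>v. \<omega> c m w v = - differential c f m v"
    have "\<omega> c m (w - u) v = 0" for v
      using w u' linear_diff[OF lin(2)] by simp
    then show "w = u"
      using nondegenerate[OF assms(2,3), of "w - u"] by simp
  qed (simp add: u')
  then show ?thesis by (simp add: u')
qed

lemma form_skew:
  assumes "c \<in> A" "m \<in> chart_dom c"
  shows "\<omega> c m u v = - \<omega> c m v u"
proof -
  have "\<omega> c m (u + v) (u + v) = 0" "\<omega> c m u u = 0" "\<omega> c m v v = 0"
    using alternating[OF assms] by auto
  then show ?thesis
    using bilinear[OF assms] by (simp add: bilinear_ladd bilinear_radd)
qed

lemma poisson_chart:
  "poisson A \<omega> f g m =
     \<omega> (chart_at m) m (ham_field \<omega> (chart_at m) f m) (ham_field \<omega> (chart_at m) g m)"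
  using ex_chart[of m] by (simp add: poisson_def chart_at_def Let_def)

lemma poisson_skew: "poisson A \<omega> f g = - poisson A \<omega> g f"
proof
  fix m
  show "poisson A \<omega> f g m = (- poisson A \<omega> g f) m"
    unfolding poisson_chart uminus_apply by (rule form_skew[OF chart_at])
qed

text \<open>The identity {f, g} = X_f g, which passes the linearity and product rules of the
  differential on to the bracket.\<close>

lemma poisson_differential:
  assumes "g \<in> differentiable_functions A"
  shows "poisson A \<omega> f g m = differential (chart_at m) g m (ham_field \<omega> (chart_at m) f m)"
proof -
  have "poisson A \<omega> f g m =
      - \<omega> (chart_at m) m (ham_field \<omega> (chart_at m) g m) (ham_field \<omega> (chart_at m) f m)"
    unfolding poisson_chart by (rule form_skew[OF chart_at])
  then show ?thesis
    using ham_field[OF assms chart_at] by simp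
qed

lemma differential_add:
  assumes "f \<in> differentiable_functions A" "g \<in> differentiable_functions A"
    and "c \<in> A" "m \<in> chart_dom c"
  shows "((f + g) \<circ> chart_inv c has_derivative (\<lambda>v. differential c f m v + differential c g m v))
    (at (chart_map c m))"
  using has_derivative_add[OF differential[OF assms(1,3,4)] differential[OF assms(2,3,4)]]
  by (simp add: o_def)

lemma differential_scale:
  assumes "f \<in> differentiable_functions A" and "c \<in> A" "m \<in> chart_dom c"
  shows "(fscale r f \<circ> chart_inv c has_derivative (\<lambda>v. r * differential c f m v))
    (at (chart_map c m))"
  using has_derivative_mult_right[OF differential[OF assms], of r]
  by (simp add: o_def fscale_apply)

lemma differential_mult:
  assumes "f \<in> differentiable_functions A" "g \<in> differentiable_functions A"
    and "c \<in> A" "m \<in> chart_dom c"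
  shows "((f * g) \<circ> chart_inv c has_derivative
      (\<lambda>v. f m * differential c g m v + differential c f m v * g m)) (at (chart_map c m))"
  using has_derivative_mult[OF differential[OF assms(1,3,4)] differential[OF assms(2,3,4)]]
  by (simp add: o_def assms(3,4))

lemma differential_one: "(1 \<circ> chart_inv c has_derivative (\<lambda>v. 0 :: real)) (at x)"
  by (simp add: o_def)

lemma differentiable_functions_algebra:
  "fun_space.subspace (differentiable_functions A)"
  "1 \<in> differentiable_functions A"
  "f \<in> differentiable_functions A \<Longrightarrow> g \<in> differentiable_functions A \<Longrightarrow>
     f * g \<in> differentiable_functions A"
proof -
  have mem: "f \<in> differentiable_functions A"
    if "\<And>c m. c \<in> A \<Longrightarrow> m \<in> chart_dom c \<Longrightarrow>
      \<exists>f'. (f \<circ> chart_inv c has_derivative f') (at (chart_map c m))" for f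
    using that by (auto simp: differentiable_functions_def differentiable_def)
  have "0 \<in> differentiable_functions A"
    by (rule mem) (auto simp: o_def intro: exI[of _ "\<lambda>_. 0"])
  moreover have "f + g \<in> differentiable_functions A"
    if "f \<in> differentiable_functions A" "g \<in> differentiable_functions A" for f g
    using differential_add[OF that] by (intro mem) blast
  moreover have "fscale r f \<in> differentiable_functions A" if "f \<in> differentiable_functions A" for r f
    using differential_scale[OF that] by (intro mem) blast
  ultimately show "fun_space.subspace (differentiable_functions A)"
    by (simp add: fun_space.subspace_def)
  show "1 \<in> differentiable_functions A"
    using differential_one by (intro mem) blast
  show "f * g \<in> differentiable_functions A"
    if "f \<in> differentiable_functions A" "g \<in> differentiable_functions A"
    using differential_mult[OF that] by (intro mem) blast
qed

lemma poisson_add: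
  assumes "g \<in> differentiable_functions A" "h \<in> differentiable_functions A"
  shows "poisson A \<omega> f (g + h) = poisson A \<omega> f g + poisson A \<omega> f h"
proof -
  have "g + h \<in> differentiable_functions A"
    using assms differentiable_functions_algebra(1) by (auto simp: fun_space.subspace_def)
  then show ?thesis
    using assms by (auto simp: fun_eq_iff poisson_differential
        differential_eqI[OF differential_add[OF assms chart_at]])
qed

lemma poisson_scale:
  assumes "g \<in> differentiable_functions A"
  shows "poisson A \<omega> f (fscale r g) = fscale r (poisson A \<omega> f g)"
proof -
  have "fscale r g \<in> differentiable_functions A"
    using assms differentiable_functions_algebra(1) by (auto simp: fun_space.subspace_def)
  then show ?thesis
    using assms by (auto simp: fun_eq_iff poisson_differential fscale_apply
        differential_eqI[OF differential_scale[OF assms chart_at]])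
qed

lemma poisson_mult:
  assumes "g \<in> differentiable_functions A" "h \<in> differentiable_functions A"
  shows "poisson A \<omega> f (g * h) = poisson A \<omega> f g * h + g * poisson A \<omega> f h"
  using assms differentiable_functions_algebra(3)[OF assms]
  by (auto simp: fun_eq_iff poisson_differential
        differential_eqI[OF differential_mult[OF assms chart_at]])

lemma poisson_one: "poisson A \<omega> f 1 = 0"
  using differentiable_functions_algebra(2)
  by (auto simp: fun_eq_iff poisson_differential differential_eqI[OF differential_one])

section \<open>Integral curves and flow-invariant closed sets\<close>

definition integral_curve :: "('m \<Rightarrow> real) \<Rightarrow> (real \<Rightarrow> 'm) \<Rightarrow> bool" where
  "integral_curve f \<gamma> \<longleftrightarrow> continuous_on UNIV \<gamma> \<and>
     (\<forall>t. \<forall>c\<in>A. \<gamma> t \<in> chart_dom c \<longrightarrow>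
        ((\<lambda>s. chart_map c (\<gamma> s)) has_vector_derivative ham_field \<omega> c f (\<gamma> t)) (at t))"

lemma integral_curve_deriv:
  assumes "integral_curve f \<gamma>" "h \<in> differentiable_functions A"
  shows "((\<lambda>s. h (\<gamma> s)) has_real_derivative poisson A \<omega> f h (\<gamma> t)) (at t)"
proof -
  let ?c = "chart_at (\<gamma> t)"
  note c = chart_at[of "\<gamma> t"]
  have "((\<lambda>s. chart_map ?c (\<gamma> s)) has_derivative (\<lambda>s. s *\<^sub>R ham_field \<omega> ?c f (\<gamma> t))) (at t)"
    using assms(1) c by (auto simp: integral_curve_def has_vector_derivative_def)
  from has_derivative_compose[OF this differential[OF assms(2) c]]
  have "((\<lambda>s. h (chart_inv ?c (chart_map ?c (\<gamma> s)))) has_derivative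
      (\<lambda>s. differential ?c h (\<gamma> t) (s *\<^sub>R ham_field \<omega> ?c f (\<gamma> t)))) (at t)"
    by (simp add: o_def)
  \<comment> \<open>By continuity the curve stays in the chart domain near \<open>t\<close>, where
    \<open>chart_inv ?c\<close> undoes \<open>chart_map ?c\<close>.\<close>
  moreover have "open (\<gamma> -` chart_dom ?c)"
    using assms(1) chart[OF c(1)] by (auto simp: integral_curve_def intro: open_vimage)
  ultimately have "((\<lambda>s. h (\<gamma> s)) has_derivative
      (\<lambda>s. differential ?c h (\<gamma> t) (s *\<^sub>R ham_field \<omega> ?c f (\<gamma> t)))) (at t)"
    by (rule has_derivative_transform_within_open) (use c in auto)
  then show ?thesis
  proof (rule has_derivative_imp_has_field_derivative)
    interpret D: bounded_linear "differential ?c h (\<gamma> t)"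
      using differential[OF assms(2) c] by (rule has_derivative_bounded_linear)
    show "s * poisson A \<omega> f h (\<gamma> t) = differential ?c h (\<gamma> t) (s *\<^sub>R ham_field \<omega> ?c f (\<gamma> t))" for s
      by (simp add: poisson_differential assms(2) D.scaleR)
  qed
qed

text \<open>An integral curve is selected separately for each starting point; invariance of a set
  refers to these selected curves.\<close>

definition flow :: "('m \<Rightarrow> real) \<Rightarrow> real \<Rightarrow> 'm \<Rightarrow> 'm" where
  "flow f t m = (SOME \<gamma>. \<gamma> 0 = m \<and> integral_curve f \<gamma>) t"

lemma flow:
  assumes "complete_ham_field A \<omega> f"
  shows "flow f 0 m = m" "integral_curve f (\<lambda>t. flow f t m)"
proof -
  have "\<exists>\<gamma>. \<gamma> 0 = m \<and> integral_curve f \<gamma>"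
    using assms by (auto simp: complete_ham_field_def integral_curve_def)
  from someI_ex[OF this] show "flow f 0 m = m" "integral_curve f (\<lambda>t. flow f t m)"
    by (simp_all add: flow_def)
qed

text \<open>If \<open>Z\<close> were not open, then in some chart there would be a point \<open>y\<close> outside \<open>Z\<close> with a
  nearest point \<open>x\<close> in \<open>Z\<close>.  By transitivity some Hamiltonian field of \<open>b\<close> at \<open>x\<close> is not orthogonal
  to \<open>x - y\<close>, so that its flow, run in the appropriate direction, stays in \<open>Z\<close> but comes closer
  to \<open>y\<close>.\<close>

lemma flow_invariant_open:
  assumes trans: "transitive_set A \<omega> b" and complete: "\<And>f. f \<in> b \<Longrightarrow> complete_ham_field A \<omega> f"
    and Z: "closed Z" "\<And>f t p. f \<in> b \<Longrightarrow> p \<in> Z \<Longrightarrow> flow f t p \<in> Z"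
  shows "open Z"
proof (subst open_subopen, intro ballI)
  fix p0 assume p0: "p0 \<in> Z"
  define c where "c = chart_at p0"
  have cA: "c \<in> A" and p0c: "p0 \<in> chart_dom c"
    using chart_at by (auto simp: c_def)
  have dom: "open (chart_dom c)" and rng: "open (chart_map c ` chart_dom c)"
    and cont: "continuous_on (chart_dom c) (chart_map c)"
      "continuous_on (chart_map c ` chart_dom c) (chart_inv c)"
    using chart[OF cA] by (auto simp: homeomorphism_def)
  define x0 where "x0 = chart_map c p0"
  obtain e where e: "e > 0" "cball x0 e \<subseteq> chart_map c ` chart_dom c"
    using rng p0c unfolding x0_def open_contains_cball by blast
  \<comment> \<open>If \<open>y\<close> is within \<open>e / 2\<close> of \<open>x0\<close>, a point
    of \<open>S\<close> nearest to \<open>y\<close> is also within \<open>e / 2\<close> of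
    \<open>y\<close>, hence inside the open \<open>e\<close>-ball, where a short piece of curve
    fits.\<close>
  define T where "T = chart_dom c \<inter> chart_map c -` ball x0 (e / 2)"
  have "q \<in> Z" if q: "q \<in> T" for q
  proof -
    define y where "y = chart_map c q"
    have qc: "q \<in> chart_dom c" and y: "dist x0 y < e / 2"
      using q by (auto simp: T_def y_def)
    define S where "S = cball x0 e \<inter> chart_inv c -` Z"
    have "closed S"
      unfolding S_def using continuous_on_subset[OF cont(2) e(2)] Z(1)
      by (intro continuous_closed_preimage) auto
    moreover have x0S: "x0 \<in> S"
      using e(1) p0 cA p0c by (simp add: S_def x0_def)
    ultimately obtain x where x: "x \<in> S" "\<And>z. z \<in> S \<Longrightarrow> dist y x \<le> dist y z"
      using distance_attains_inf[of S y] by auto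
    have "dist x0 x \<le> dist x0 y + dist y x"
      by (rule dist_triangle)
    then have xe: "x \<in> ball x0 e"
      using x(2)[OF x0S] y by (simp add: dist_commute)
    define p where "p = chart_inv c x"
    have "x \<in> chart_map c ` chart_dom c"
      using x(1) e(2) by (auto simp: S_def)
    then have pc: "p \<in> chart_dom c" and px: "chart_map c p = x"
      using cA by (auto simp: p_def)
    have pZ: "p \<in> Z"
      using x(1) by (simp add: S_def p_def)
    have "x = y"
    proof (rule ccontr)
      assume "x \<noteq> y"
      have "\<exists>f\<in>b. ham_field \<omega> c f p \<bullet> (x - y) \<noteq> 0"
      proof (rule ccontr)
        assume *: "\<not> ?thesis"
        have "x - y \<in> span {ham_field \<omega> c f p | f. f \<in> b}"
          using trans cA pc by (auto simp: transitive_set_def)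
        moreover have "subspace {w. w \<bullet> (x - y) = 0}"
          by (auto simp: subspace_def inner_add_left)
        ultimately have "(x - y) \<bullet> (x - y) = 0"
          using * span_minimal[of "{ham_field \<omega> c f p | f. f \<in> b}" "{w. w \<bullet> (x - y) = 0}"] by blast
        then show False
          using \<open>x \<noteq> y\<close> by simp
      qed
      then obtain f where f: "f \<in> b" "ham_field \<omega> c f p \<bullet> (x - y) \<noteq> 0" by blast
      define \<gamma> where "\<gamma> t = flow f t p" for t
      have \<gamma>0: "\<gamma> 0 = p" and \<gamma>: "integral_curve f \<gamma>"
        using flow[OF complete[OF f(1)]] by (auto simp: \<gamma>_def[abs_def])
      have \<gamma>_cont: "continuous_on UNIV \<gamma>"
        using \<gamma> by (simp add: integral_curve_def)
      have \<gamma>Z: "\<gamma> t \<in> Z" for t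
        using Z(2)[OF f(1) pZ] by (simp add: \<gamma>_def)
      define d where "d t = (norm (chart_map c (\<gamma> t) - y))\<^sup>2" for t
      have "((\<lambda>t. chart_map c (\<gamma> t)) has_vector_derivative ham_field \<omega> c f p) (at 0)"
        using \<gamma> cA pc \<gamma>0 by (auto simp: integral_curve_def)
      then have "((\<lambda>t. chart_map c (\<gamma> t)) has_derivative (\<lambda>s. s *\<^sub>R ham_field \<omega> c f p)) (at 0)"
        by (simp add: has_vector_derivative_def)
      then have "((\<lambda>t. (chart_map c (\<gamma> t) - y) \<bullet> (chart_map c (\<gamma> t) - y)) has_derivative
          (\<lambda>s. s * (2 * (ham_field \<omega> c f p \<bullet> (x - y))))) (at 0)"
        by (auto intro!: derivative_eq_intros simp: \<gamma>0 px inner_commute)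
      then have d: "(d has_real_derivative 2 * (ham_field \<omega> c f p \<bullet> (x - y))) (at 0)"
        unfolding d_def power2_norm_eq_inner
        by (rule has_derivative_imp_has_field_derivative) simp
      define N where "N = \<gamma> -` (chart_dom c \<inter> chart_map c -` ball x0 e)"
      have "open (chart_dom c \<inter> chart_map c -` ball x0 e)"
        using cont(1) dom by (intro continuous_open_preimage) auto
      then have "open N"
        unfolding N_def using \<gamma>_cont by (rule open_vimage)
      moreover have "0 \<in> N"
        using xe pc by (simp add: N_def \<gamma>0 px)
      ultimately obtain \<delta> where \<delta>: "\<delta> > 0" "ball 0 \<delta> \<subseteq> N"
        using open_contains_ball by blast
      \<comment> \<open>For small times the curve stays in \<open>S\<close>, so minimality of
        \<open>x\<close> makes \<open>0\<close> a local minimum of \<open>d\<close>, against its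
        nonzero derivative.\<close>
      have "d 0 \<le> d t" if "\<bar>0 - t\<bar> < \<delta>" for t
      proof -
        have "t \<in> N"
          using that \<delta>(2) by (auto simp: dist_real_def)
        then have "chart_map c (\<gamma> t) \<in> S"
          using cA \<gamma>Z by (auto simp: N_def S_def)
        from x(2)[OF this] show ?thesis
          by (simp add: d_def \<gamma>0 px dist_norm norm_minus_commute power_mono)
      qed
      then have "2 * (ham_field \<omega> c f p \<bullet> (x - y)) = 0"
        using \<delta>(1) by (intro DERIV_local_min[OF d]) auto
      then show False
        using f(2) by simp
    qed
    then show "q \<in> Z"
      using pZ cA qc by (simp add: p_def y_def)
  qed
  moreover have "open T"
    unfolding T_def using cont(1) dom by (intro continuous_open_preimage) auto
  moreover have "p0 \<in> T"
    using p0c e(1) by (simp add: T_def x0_def)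
  ultimately show "\<exists>T. open T \<and> p0 \<in> T \<and> T \<subseteq> Z" by blast
qed

end

section \<open>The Poisson algebra of polynomials\<close>

lemma poly_algebra:
  shows "fun_space.subspace (poly_algebra b)"
    and poly_algebra_one: "1 \<in> poly_algebra b"
    and "f \<in> poly_algebra b \<Longrightarrow> g \<in> poly_algebra b \<Longrightarrow> f * g \<in> poly_algebra b"
proof -
  have "fun_space.subspace (poly_algebra b) \<and> 1 \<in> poly_algebra b \<and>
      (\<forall>f\<in>poly_algebra b. \<forall>g\<in>poly_algebra b. f * g \<in> poly_algebra b)"
    unfolding poly_algebra_def
    by (rule hull_in) (auto simp: fun_space.subspace_def)
  then show "fun_space.subspace (poly_algebra b)" "1 \<in> poly_algebra b"
    "f \<in> poly_algebra b \<Longrightarrow> g \<in> poly_algebra b \<Longrightarrow> f * g \<in> poly_algebra b"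
    by auto
qed

lemma poly_algebra_superset: "b \<subseteq> poly_algebra b"
  unfolding poly_algebra_def by (rule hull_subset)

lemma poly_algebra_minimal:
  assumes "b \<subseteq> V" "fun_space.subspace V" "1 \<in> V" "\<And>f g. f \<in> V \<Longrightarrow> g \<in> V \<Longrightarrow> f * g \<in> V"
  shows "poly_algebra b \<subseteq> V"
  unfolding poly_algebra_def using assms by (intro hull_minimal) auto

lemma span_mult:
  fixes B C :: "('a \<Rightarrow> real) set"
  assumes "f \<in> fun_space.span B" "g \<in> fun_space.span C"
  shows "f * g \<in> fun_space.span ((\<lambda>(x, y). x * y) ` (B \<times> C))" (is "_ \<in> ?S")
proof -
  have scale: "fscale r x * y = fscale r (x * y)" "x * fscale r y = fscale r (x * y)"
    for r and x y :: "'a \<Rightarrow> real"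
    by (auto simp: fun_eq_iff fscale_apply)
  have 1: "x * g \<in> ?S" if "x \<in> B" for x
  proof -
    have "fun_space.subspace {y. x * y \<in> ?S}"
      by (auto simp: fun_space.subspace_def distrib_left scale
          intro: fun_space.span_zero fun_space.span_add fun_space.span_scale)
    moreover have "C \<subseteq> {y. x * y \<in> ?S}"
      using that by (auto intro!: fun_space.span_base)
    ultimately show ?thesis
      using fun_space.span_minimal assms(2) by blast
  qed
  have "fun_space.subspace {x. x * g \<in> ?S}"
    by (auto simp: fun_space.subspace_def distrib_right scale
        intro: fun_space.span_zero fun_space.span_add fun_space.span_scale)
  then show ?thesis
    using fun_space.span_minimal[of B "{x. x * g \<in> ?S}"] 1 assms(1) by blast
qed

context symplectic_atlas
begin

text \<open>The Leibniz rule reduces brackets of polynomials to brackets of generators, one argument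
  at a time.\<close>

lemma poisson_poly_algebra:
  assumes b: "b \<subseteq> differentiable_functions A" "bracket_closed (poisson A \<omega>) b"
  shows "poisson_function_algebra (poly_algebra b) (poisson A \<omega>)"
proof -
  let ?P = "poly_algebra b"
  note P = poly_algebra[where b = b]
  note P_add = fun_space.subspace_add[OF P(1)] and P_scale = fun_space.subspace_scale[OF P(1)]
    and P_neg = fun_space.subspace_neg[OF P(1)] and P_zero = fun_space.subspace_0[OF P(1)]
  have PD: "?P \<subseteq> differentiable_functions A"
    using b(1) differentiable_functions_algebra by (intro poly_algebra_minimal) auto
  have poisson_zero: "poisson A \<omega> g 0 = 0" for g
    using poisson_scale[of 0 g 0] PD P_zero by auto
  \<comment> \<open>Applied with \<open>S = b\<close> for brackets with a generator, then with
    \<open>S = ?P\<close> after exchanging the arguments by skew symmetry.\<close>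
  have stable: "?P \<subseteq> {f \<in> ?P. \<forall>g\<in>S. poisson A \<omega> g f \<in> ?P}"
    if S: "S \<subseteq> ?P" and bS: "\<And>f g. f \<in> b \<Longrightarrow> g \<in> S \<Longrightarrow> poisson A \<omega> g f \<in> ?P" for S
  proof (rule poly_algebra_minimal)
    show "b \<subseteq> {f \<in> ?P. \<forall>g\<in>S. poisson A \<omega> g f \<in> ?P}"
      using bS poly_algebra_superset by auto
    show "fun_space.subspace {f \<in> ?P. \<forall>g\<in>S. poisson A \<omega> g f \<in> ?P}"
      unfolding fun_space.subspace_def using PD
      by (auto simp: poisson_add poisson_scale poisson_zero subset_iff P_zero intro!: P_add P_scale)
    show "1 \<in> {f \<in> ?P. \<forall>g\<in>S. poisson A \<omega> g f \<in> ?P}"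
      by (simp add: poisson_one P P_zero)
    show "f * h \<in> {f \<in> ?P. \<forall>g\<in>S. poisson A \<omega> g f \<in> ?P}"
      if "f \<in> {f \<in> ?P. \<forall>g\<in>S. poisson A \<omega> g f \<in> ?P}" "h \<in> {f \<in> ?P. \<forall>g\<in>S. poisson A \<omega> g f \<in> ?P}"
      for f h
    proof -
      have "f \<in> differentiable_functions A" "h \<in> differentiable_functions A"
        using that PD by auto
      then show ?thesis
        using that by (auto simp: poisson_mult intro!: P P_add)
    qed
  qed
  have 1: "poisson A \<omega> g f \<in> ?P" if "g \<in> b" "f \<in> ?P" for f g
    using stable[OF poly_algebra_superset] b(2) poly_algebra_superset that
    by (auto simp: bracket_closed_def subset_iff)
  have 2: "poisson A \<omega> g f \<in> ?P" if "g \<in> ?P" "f \<in> ?P" for f g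
  proof -
    have "poisson A \<omega> g f \<in> ?P" if "f \<in> b" "g \<in> ?P" for f g
      using P_neg[OF 1[OF that]] poisson_skew[of g f] by simp
    then show ?thesis
      using stable[of ?P] that by blast
  qed
  show ?thesis
  proof
    show "f \<in> ?P \<Longrightarrow> g \<in> ?P \<Longrightarrow> poisson A \<omega> f g = - poisson A \<omega> g f" for f g
      by (rule poisson_skew)
  qed (use P 2 PD in \<open>auto intro!: poisson_add poisson_scale poisson_mult\<close>)
qed

text \<open>The elements of \<open>b\<close> act as derivations and preserve \<open>b\<close>, so
  polynomials of bounded degree form a stable finite-dimensional space.\<close>

lemma poly_algebra_locally_finite:
  assumes b: "b \<subseteq> differentiable_functions A" "fun_space.subspace b" "finite_dimensional b"
    "bracket_closed (poisson A \<omega>) b"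
    and f: "f \<in> poly_algebra b"
  shows "\<exists>V. fun_space.subspace V \<and> finite_dimensional V \<and> V \<subseteq> poly_algebra b \<and> f \<in> V \<and>
    (\<forall>g\<in>b. \<forall>h\<in>V. poisson A \<omega> g h \<in> V)"
proof -
  let ?P = "poly_algebra b" and ?br = "poisson A \<omega>"
  interpret poisson_function_algebra ?P ?br
    using b(1,4) by (rule poisson_poly_algebra)
  note bP = poly_algebra_superset[of b, THEN subsetD]
  \<comment> \<open>Finite spanning sets of stable spaces are easy to combine: unions serve sums,
    and pairwise products serve products.\<close>
  define stab where "stab B \<longleftrightarrow> finite B \<and> B \<subseteq> ?P \<and> (\<forall>g\<in>b. \<forall>x\<in>B. ?br g x \<in> fun_space.span B)"
    for B :: "('m \<Rightarrow> real) set"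
  have stab_span: "?br g x \<in> fun_space.span B" if "stab B" "g \<in> b" "x \<in> fun_space.span B" for B g x
  proof -
    have "fun_space.subspace {x \<in> ?P. ?br g x \<in> fun_space.span B}"
      using bP[OF that(2)] unfolding fun_space.subspace_def
      by (auto simp: br_zero br_add br_scale zero add scale
          intro: fun_space.span_zero fun_space.span_add fun_space.span_scale)
    moreover have "B \<subseteq> {x \<in> ?P. ?br g x \<in> fun_space.span B}"
      using that by (auto simp: stab_def)
    ultimately show ?thesis
      using fun_space.span_minimal that(3) by blast
  qed
  have stab_Un: "stab (B \<union> C)" if "stab B" "stab C" for B C
    using that fun_space.span_mono[of B "B \<union> C"] fun_space.span_mono[of C "B \<union> C"]
    by (auto simp: stab_def)
  have stab_mult: "stab ((\<lambda>(x, y). x * y) ` (B \<times> C))" if "stab B" "stab C" for B C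
    unfolding stab_def
  proof (intro conjI ballI)
    fix g z assume g: "g \<in> b" and "z \<in> (\<lambda>(x, y). x * y) ` (B \<times> C)"
    then obtain x y where xy: "x \<in> B" "y \<in> C" "z = x * y" by auto
    have "x \<in> ?P" "y \<in> ?P"
      using that xy by (auto simp: stab_def)
    then have "?br g z = ?br g x * y + x * ?br g y"
      using bP[OF g] by (simp add: xy(3) leibniz)
    moreover have "x \<in> fun_space.span B" "?br g x \<in> fun_space.span B"
      "y \<in> fun_space.span C" "?br g y \<in> fun_space.span C"
      using that g xy by (auto simp: stab_def intro: fun_space.span_base)
    ultimately show "?br g z \<in> fun_space.span ((\<lambda>(x, y). x * y) ` (B \<times> C))"
      by (simp add: fun_space.span_add span_mult)
  qed (use that in \<open>auto simp: stab_def intro!: mult\<close>)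
  define F where "F = {f. \<exists>B. stab B \<and> f \<in> fun_space.span B}"
  have "?P \<subseteq> F"
  proof (rule poly_algebra_minimal)
    obtain B where B: "finite B" "B \<subseteq> b" "b \<subseteq> fun_space.span B"
      using b(3) by (auto simp: finite_dimensional_def)
    then have "stab B"
      using b(4) bP by (auto simp: stab_def bracket_closed_def subset_iff)
    then show "b \<subseteq> F"
      using B(3) by (auto simp: F_def)
    have "stab {1}"
      by (simp add: stab_def one poisson_one fun_space.span_zero)
    then show "1 \<in> F"
      unfolding F_def by (blast intro: fun_space.span_base)
    show "fun_space.subspace F"
      unfolding fun_space.subspace_def
    proof (intro conjI ballI allI)
      show "0 \<in> F"
        using \<open>stab {1}\<close> fun_space.span_zero unfolding F_def by blast
      fix f g r assume "f \<in> F" "g \<in> F"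
      then obtain B C where BC: "stab B" "stab C" "f \<in> fun_space.span B" "g \<in> fun_space.span C"
        by (auto simp: F_def)
      then have "f \<in> fun_space.span (B \<union> C)" "g \<in> fun_space.span (B \<union> C)"
        using fun_space.span_mono[of B "B \<union> C"] fun_space.span_mono[of C "B \<union> C"] by auto
      then show "f + g \<in> F"
        using stab_Un[OF BC(1,2)] fun_space.span_add unfolding F_def by blast
    next
      fix f r assume "f \<in> F"
      then show "fscale r f \<in> F"
        using fun_space.span_scale unfolding F_def by blast
    qed
    fix f g assume "f \<in> F" "g \<in> F"
    then show "f * g \<in> F"
      unfolding F_def using stab_mult span_mult by blast
  qed
  then obtain B where B: "stab B" "f \<in> fun_space.span B"
    using f by (auto simp: F_def)
  then have "fun_space.span B \<subseteq> ?P" "finite_dimensional (fun_space.span B)"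
    using fun_space.span_minimal[OF _ subspace] finite_dimensional_span by (auto simp: stab_def)
  then show ?thesis
    using B stab_span by (intro exI[of _ "fun_space.span B"]) auto
qed

lemma poly_algebra_transitive:
  assumes "compact (UNIV :: 'm set)" and conn: "connected (UNIV :: 'm set)"
    and b: "lie_subalgebra A \<omega> b" "finite_dimensional b" "transitive_set A \<omega> b"
      "\<And>f. f \<in> b \<Longrightarrow> complete_ham_field A \<omega> f"
  shows "transitive_poisson_algebra (poly_algebra b) (poisson A \<omega>) b flow"
proof -
  have bD: "b \<subseteq> differentiable_functions A" "fun_space.subspace b" "bracket_closed (poisson A \<omega>) b"
    using b(1) smooth_functions_differentiable by (auto simp: lie_subalgebra_def)
  have PD: "poly_algebra b \<subseteq> differentiable_functions A"
    using bD(1) differentiable_functions_algebra by (intro poly_algebra_minimal) auto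
  interpret poisson_function_algebra "poly_algebra b" "poisson A \<omega>"
    using bD(1,3) by (rule poisson_poly_algebra)
  show ?thesis
  proof
    show "((\<lambda>t. h (flow g t m)) has_real_derivative poisson A \<omega> g h (flow g t m)) (at t)"
      if "g \<in> b" "h \<in> poly_algebra b" for g h m t
      using integral_curve_deriv[OF flow(2)[OF b(4)[OF that(1)]]] PD that(2) by blast
    fix Z :: "'m set"
    assume Z: "closed Z" "Z \<noteq> {}" "\<And>g t p. g \<in> b \<Longrightarrow> p \<in> Z \<Longrightarrow> flow g t p \<in> Z"
    \<comment> \<open>Infinitesimal transitivity enters here; \<open>Z\<close> is then clopen, and
      connectedness concludes.\<close>
    have "open Z"
      using flow_invariant_open[OF b(3,4) Z(1,3)] by blast
    then show "Z = UNIV"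
      using conn Z(1,2) by (auto simp: connected_clopen)
  qed (use assms(1) PD flow(1)[OF b(4)] poly_algebra_superset[of b] continuous_differentiable_function
      poly_algebra_locally_finite[OF bD(1,2) b(2) bD(3)] in \<open>auto\<close>)
qed

end

section \<open>Finite-dimensional prequantizations\<close>

lemma cinner_scaleC_left: "cinner (z *\<^sub>C x) y = cnj z * cinner x y"
  by (metis cinner_commute cinner_scaleC_right complex_cnj_mult)

lemma cinner_add_left: "cinner (x + x') y = cinner x y + cinner x' y"
  by (metis cinner_add_right cinner_commute complex_cnj_add)

lemma cinner_scaleR_left: "cinner (r *\<^sub>R x) y = of_real r * cinner x y"
  using cinner_scaleC_left[of "of_real r" x y] by (simp add: scaleC_of_real)

lemma cinner_eq_zero_span:
  assumes "complex_space.span B = UNIV" "\<And>e. e \<in> B \<Longrightarrow> cinner x e = 0"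
  shows "x = 0"
proof -
  have zero: "cinner x 0 = 0"
    using cinner_scaleC_right[of x 0 0] by simp
  have "complex_space.subspace {y. cinner x y = 0}"
    by (auto simp: complex_space.subspace_def zero cinner_add_right cinner_scaleC_right)
  then have "complex_space.span B \<subseteq> {y. cinner x y = 0}"
    using assms(2) by (intro complex_space.span_minimal) auto
  then have "cinner x x = 0"
    using assms(1) by blast
  then have "Re (cinner x x) = 0"
    by simp
  then show ?thesis
    by (simp add: Re_cinner)
qed

text \<open>The equation \<open>Q f = 0\<close> follows from the vanishing of finitely many matrix
  coefficients, between a basis of \<open>D\<close> and a spanning set of the whole space. Real and
  imaginary parts are taken because \<open>P\<close> is a real space.\<close>

lemma prequantization_kernel_cofinite:
  fixes D :: "'h::separable_hilbert set"
  assumes Q: "prequantization A \<omega> hbar D P Q"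
    and "\<exists>B :: 'h set. finite B \<and> complex_space.span B = UNIV"
  shows "\<exists>L. finite L \<and> (\<forall>l\<in>L. functional_on P l) \<and>
    {f \<in> P. \<forall>l\<in>L. l f = 0} \<subseteq> {f \<in> P. Q f = 0}"
proof -
  obtain B :: "'h set" where B: "finite B" "complex_space.span B = UNIV"
    using assms(2) by blast
  have D: "complex_space.subspace D" and Op: "\<And>f. f \<in> P \<Longrightarrow> Q f \<in> Op D"
    and Q_add: "\<And>f g. f \<in> P \<Longrightarrow> g \<in> P \<Longrightarrow> Q (f + g) = Q f + Q g"
    and Q_scale: "\<And>r f. f \<in> P \<Longrightarrow> Q (fscale r f) = fscale r (Q f)"
    using Q by (auto simp: prequantization_def)
  obtain E where E: "E \<subseteq> D" "complex_space.independent E" "D \<subseteq> complex_space.span E"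
    by (rule complex_space.maximal_independent_subset)
  have "finite E"
    using complex_space.independent_span_bound[OF B(1) E(2)] B(2) by simp
  define L where "L = (\<Union>d\<in>E. \<Union>e\<in>B. {\<lambda>f. Re (cinner (Q f d) e), \<lambda>f. Im (cinner (Q f d) e)})"
  have "finite L"
    using \<open>finite E\<close> B(1) by (simp add: L_def)
  moreover have "functional_on P l" if "l \<in> L" for l
    using that by (auto simp: L_def functional_on_def Q_add Q_scale fscale_apply
        cinner_add_left cinner_scaleR_left)
  moreover have "Q f = 0" if f: "f \<in> P" "\<forall>l\<in>L. l f = 0" for f
  proof
    fix x
    have zero: "Q f d = 0" if "d \<in> E" for d
    proof (rule cinner_eq_zero_span[OF B(2)])
      fix e assume "e \<in> B"
      then have "(\<lambda>f. Re (cinner (Q f d) e)) \<in> L" "(\<lambda>f. Im (cinner (Q f d) e)) \<in> L"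
        using that by (auto simp: L_def)
      then have "Re (cinner (Q f d) e) = 0" "Im (cinner (Q f d) e) = 0"
        using f(2) by auto
      then show "cinner (Q f d) e = 0"
        by (simp add: complex_eq_iff)
    qed
    have T: "\<And>x. x \<notin> D \<Longrightarrow> Q f x = 0"
      "\<And>x y. x \<in> D \<Longrightarrow> y \<in> D \<Longrightarrow> Q f (x + y) = Q f x + Q f y"
      "\<And>z x. x \<in> D \<Longrightarrow> Q f (z *\<^sub>C x) = z *\<^sub>C Q f x"
      using Op[OF f(1)] by (auto simp: Op_def)
    have D0: "0 \<in> D" using D by (rule complex_space.subspace_0)
    then have "Q f 0 = 0"
      using T(3)[of 0 0] by simp
    then have "complex_space.subspace {x \<in> D. Q f x = 0}"
      using D D0 T(2,3) by (auto simp: complex_space.subspace_def)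
    moreover have "E \<subseteq> {x \<in> D. Q f x = 0}"
      using E(1) zero by auto
    ultimately have "D \<subseteq> {x \<in> D. Q f x = 0}"
      using E(3) complex_space.span_minimal by (metis subset_trans)
    then show "Q f x = 0 x"
      using T(1)[of x] by auto
  qed
  ultimately show ?thesis by blast
qed

text \<open>For \<open>Q f = 0\<close> the commutator at \<open>x\<close> reduces to a multiple of
  \<open>Q g 0\<close>, which vanishes because \<open>Q g\<close> is linear on a subspace.\<close>

lemma prequantization_kernel_ideal:
  assumes Q: "prequantization A \<omega> hbar D P Q" and "f \<in> P" "g \<in> P" "Q f = 0"
  shows "Q (poisson A \<omega> f g) = 0"
proof -
  have "Q g \<in> Op D" and D: "complex_space.subspace D"
    and br: "Q (poisson A \<omega> f g) = op_bracket hbar (Q f) (Q g)"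
    using Q assms(2,3) by (auto simp: prequantization_def)
  then have "Q g (0 *\<^sub>C 0) = 0 *\<^sub>C Q g 0"
    using complex_space.subspace_0[OF D] unfolding Op_def by blast
  then have "Q g 0 = 0" by simp
  then show ?thesis
    by (auto simp: br op_bracket_def fun_eq_iff assms(4))
qed

theorem corollary23:
  fixes A :: "('m::{t2_space, second_countable_topology}, 'e::euclidean_space) chart set"
    and \<omega> :: "('m, 'e) two_form"
    and b :: "('m \<Rightarrow> real) set"
    and hbar :: real
  assumes "symplectic_manifold A \<omega>"
    and "compact (UNIV :: 'm set)"
    and "connected (UNIV :: 'm set)"
    and "hbar > 0"
    and "basic_algebra A \<omega> b"
    and "finite_dimensional b"
    and "\<exists>B :: 'h::separable_hilbert set. finite B \<and> complex_space.span B = UNIV"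
  shows "(\<nexists>(D :: 'h set) Q.
            prequantization A \<omega> hbar D (poly_algebra b) Q \<and> nontrivial (poly_algebra b) Q) \<and>
         (\<nexists>(D :: 'h set) Q.
            quantization A \<omega> hbar D (poly_algebra b) b Q \<and> nontrivial (poly_algebra b) Q)"
proof -
  let ?P = "poly_algebra b"
  have "\<not> nontrivial ?P Q" if Q: "prequantization A \<omega> hbar D ?P Q"
    for D :: "'h set" and Q
  proof -
    define K where "K = {f \<in> ?P. Q f = 0}"
    have "?P \<subseteq> fun_space.span (K \<union> {1})"
    proof (cases "A = {}")
      \<comment> \<open>Dimension zero: a connected discrete space is a single point, so all
        functions are constant.\<close>
      case True
      interpret symplectic_manifold A \<omega> by fact
      have "open {m}" for m :: 'm
        using cover True by auto
      then have "UNIV = {m}" for m :: 'm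
        using assms(3) closed_singleton[of m] by (auto simp: connected_clopen)
      then have m: "m = m'" for m m' :: 'm
        by (metis UNIV_I singletonD)
      have "f \<in> fun_space.span (K \<union> {1})" for f :: "'m \<Rightarrow> real"
      proof -
        have "f x = fscale (f undefined) 1 x" for x
          using m[of x undefined] by (simp add: fscale_apply)
        then have "f = fscale (f undefined) 1" by blast
        moreover have "fscale (f undefined) 1 \<in> fun_space.span (K \<union> {1})"
          by (intro fun_space.span_scale fun_space.span_base) simp
        ultimately show ?thesis by simp
      qed
      then show ?thesis by blast
    next
      case False
      then interpret symplectic_atlas A \<omega>
        using assms(1) by (simp add: symplectic_atlas_def symplectic_atlas_axioms_def)
      interpret transitive_poisson_algebra ?P "poisson A \<omega>" b flow
        using assms(5)
        by (intro poly_algebra_transitive assms)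
          (auto simp: basic_algebra_def pre_basic_def)
      obtain L where "finite L" "\<And>l. l \<in> L \<Longrightarrow> functional_on ?P l" "{f \<in> ?P. \<forall>l\<in>L. l f = 0} \<subseteq> K"
        using prequantization_kernel_cofinite[OF Q assms(7)] unfolding K_def by blast
      moreover have "fun_space.subspace K"
      proof -
        have "Q (fscale 0 0) = fscale 0 (Q 0)"
          using Q zero by (simp only: prequantization_def)
        then show ?thesis
          using Q by (auto simp: K_def fun_space.subspace_def prequantization_def zero add scale)
      qed
      moreover have "poisson A \<omega> f g \<in> K" if "f \<in> K" "g \<in> ?P" for f g
        using that prequantization_kernel_ideal[OF Q] by (auto simp: K_def br_mem)
      ultimately show ?thesis
        by (intro cofinite_lie_ideal[OF assms(3)]) (auto simp: K_def)
    qed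
    then have "codim_le 1 K ?P"
      unfolding codim_le_def by (intro exI[of _ "{1}"]) (auto simp: poly_algebra_one)
    then show ?thesis
      by (simp add: nontrivial_def K_def)
  qed
  then show ?thesis
    by (auto simp: quantization_def)
qed

end
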